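(* For every $d\ge 1$, no topological dynamical system $(X,T,H_{2d+1}(\mathbb{Z}))$, where $H_{2d+1}(\mathbb{Z})$ is the discrete Heisenberg group, has $(4d+2)$-fold strong topological minimal self-joinings.
   Context: The discrete Heisenberg group $H_{2d+1}(\mathbb{Z})$ is the set of triples $(\vec v,\vec u,t)\in\mathbb{Z}^d\times\mathbb{Z}^d\times\mathbb{Z}$ with product $(\vec v_1,\vec u_1,t_1)(\vec v_2,\vec u_2,t_2)=(\vec v_1+\vec v_2,\vec u_1+\vec u_2,t_1+t_2+\langle\vec v_1,\vec u_2\rangle)$. A topological dynamical system $(X,T,G)$ is a compact metric space $X$ with a continuous action $T$ of $G$, written $T^g\colon X\to X$, with $T^{1_G}=\mathrm{id}_X$ and $T^{g}\circ T^{g'}=T^{gg'}$. $Z(G)$ denotes the center of $G$. For $n\ge 1$, $(X,T,G)$ has $n$-fold strong topological minimal self-joinings ($n$-fold sTMSJ) if $X$ is infinite and for every $1\le k\le n$ and every $k$ distinct points $x_1,\dots,x_k\in X$ all lying in different $Z(G)$-orbits, the orbit $\{(T^gx_1,\dots,T^gx_k): g\in G\}$ is dense in $X^k$. In particular such a system is minimal. *)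

theory Defs
  imports "HOL-Analysis.Analysis" "HOL-Algebra.Group_Action"
begin

type_synonym 'd heisenberg = "(int ^ 'd) \<times> (int ^ 'd) \<times> int"

text \<open>The discrete Heisenberg group \<open>H\<^bsub>2d+1\<^esub>(\<int>)\<close> with \<open>d = CARD('d)\<close>.\<close>

definition heisenberg_group :: "('d::finite) heisenberg monoid" where
  "heisenberg_group =
     \<lparr>carrier = UNIV,
      mult = (\<lambda>(v1, u1, t1) (v2, u2, t2).
                (v1 + v2, u1 + u2, t1 + t2 + (\<Sum>i\<in>UNIV. v1 $ i * u2 $ i))),
      one = (0, 0, 0)\<rparr>"

lemma group_heisenberg_group: "group (heisenberg_group :: ('d::finite) heisenberg monoid)"
proof (rule groupI)
  fix x :: "'d heisenberg"
  obtain v u t where x: "x = (v, u, t)" by (cases x)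
  have "(- v, - u, - t + (\<Sum>i\<in>UNIV. v $ i * u $ i)) \<otimes>\<^bsub>heisenberg_group\<^esub> x
          = \<one>\<^bsub>heisenberg_group\<^esub>"
    by (simp add: heisenberg_group_def x sum_negf)
  then show "\<exists>y\<in>carrier heisenberg_group.
      y \<otimes>\<^bsub>heisenberg_group\<^esub> x = \<one>\<^bsub>heisenberg_group\<^esub>"
    by (rule bexI) (simp add: heisenberg_group_def)
qed (auto simp: heisenberg_group_def algebra_simps sum.distrib)

definition group_center :: "('g, 'm) monoid_scheme \<Rightarrow> 'g set" where
  "group_center G = {z \<in> carrier G. \<forall>g\<in>carrier G. z \<otimes>\<^bsub>G\<^esub> g = g \<otimes>\<^bsub>G\<^esub> z}"

text \<open>The group is discrete, so continuity of the action means that each \<open>T g\<close> is continuous.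
  The library's \<open>group_action\<close> normalises each \<open>T g\<close> to be \<open>undefined\<close> outside \<open>X\<close>; the lemma
  \<open>topological_dynamical_systemI\<close> shows that this is no restriction.\<close>

locale topological_dynamical_system = group_action G X T
  for G :: "('g, 'm) monoid_scheme" (structure)
    and X :: "'a::metric_space set" and T :: "'g \<Rightarrow> 'a \<Rightarrow> 'a" +
  assumes compact_space: "compact X"
    and continuous_action: "g \<in> carrier G \<Longrightarrow> continuous_on X (T g)"

lemma topological_dynamical_systemI:
  fixes X :: "'a::metric_space set"
  assumes G: "group G" and X: "compact X"
    and maps: "\<And>g. g \<in> carrier G \<Longrightarrow> T g \<in> X \<rightarrow> X"
    and cont: "\<And>g. g \<in> carrier G \<Longrightarrow> continuous_on X (T g)"
    and one: "\<And>x. x \<in> X \<Longrightarrow> T \<one>\<^bsub>G\<^esub> x = x"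
    and mult: "\<And>g h x. g \<in> carrier G \<Longrightarrow> h \<in> carrier G \<Longrightarrow> x \<in> X \<Longrightarrow>
                 T (g \<otimes>\<^bsub>G\<^esub> h) x = T g (T h x)"
  shows "topological_dynamical_system G X (\<lambda>g. restrict (T g) X)"
proof -
  interpret group G by (rule G)
  have inv: "T (inv\<^bsub>G\<^esub> g) (T g x) = x" "T g (T (inv\<^bsub>G\<^esub> g) x) = x"
    if "g \<in> carrier G" "x \<in> X" for g x
    using that mult[of "inv\<^bsub>G\<^esub> g" g x] mult[of g "inv\<^bsub>G\<^esub> g" x] one by auto
  have Bij: "restrict (T g) X \<in> Bij X" if g: "g \<in> carrier G" for g
  proof -
    have "bij_betw (T g) X X"
      by (rule bij_betw_byWitness[where f' = "T (inv\<^bsub>G\<^esub> g)"])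
        (use g inv maps[OF g] maps[OF inv_closed[OF g]] in auto)
    then show ?thesis by (simp add: Bij_def)
  qed
  have "(\<lambda>g. restrict (T g) X) \<in> hom G (BijGroup X)"
  proof (rule homI)
    fix g h assume gh: "g \<in> carrier G" "h \<in> carrier G"
    show "restrict (T (g \<otimes>\<^bsub>G\<^esub> h)) X
            = restrict (T g) X \<otimes>\<^bsub>BijGroup X\<^esub> restrict (T h) X"
      using gh Bij maps[OF gh(2)] mult[OF gh]
      by (auto simp: BijGroup_def compose_def fun_eq_iff)
  qed (simp add: Bij BijGroup_def)
  then have "group_action G X (\<lambda>g. restrict (T g) X)"
    by (simp add: group_action_def group_hom_def group_hom_axioms_def G group_BijGroup)
  then show ?thesis
    using X cont
    by (simp add: topological_dynamical_system_def topological_dynamical_system_axioms_def)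
qed

text \<open>The points \<open>x\<^sub>1, \<dots>, x\<^sub>k\<close> are indexed from \<open>0\<close>, and \<open>X\<^sup>k\<close> is the
  set of extensional functions \<open>{..<k} \<rightarrow>\<^sub>E X\<close> with the product topology.\<close>

definition strong_TMSJ ::
  "nat \<Rightarrow> ('g, 'm) monoid_scheme \<Rightarrow> 'a::metric_space set \<Rightarrow> ('g \<Rightarrow> 'a \<Rightarrow> 'a) \<Rightarrow> bool" where
  "strong_TMSJ n G X T \<longleftrightarrow>
     infinite X \<and>
     (\<forall>k x. 1 \<le> k \<and> k \<le> n \<and> x ` {..<k} \<subseteq> X \<and> inj_on x {..<k} \<and>
        (\<forall>i<k. \<forall>j<k. i \<noteq> j \<longrightarrow>
           orbit (G\<lparr>carrier := group_center G\<rparr>) T (x i)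
             \<noteq> orbit (G\<lparr>carrier := group_center G\<rparr>) T (x j))
        \<longrightarrow> product_topology (\<lambda>i. top_of_set X) {..<k} closure_of
               {\<lambda>i\<in>{..<k}. T g (x i) | g. g \<in> carrier G}
             = ({..<k} \<rightarrow>\<^sub>E X))"

end

theory Submission
  imports Defs
begin

text \<open>
  Call a horizontal unit vector \<open>\<xi>\<close> an exit direction at scale \<open>\<epsilon>\<close> if some pair of points at distance
  at least \<open>\<epsilon>\<close> stays \<open>\<epsilon>\<close>-close under all group elements in the open half-space determined by \<open>\<xi>\<close>.
  If \<open>0\<close> is in the convex hull of the exit directions, then by Caratheodory \<open>2d + 1\<close> of the closed
  half-spaces cover the group, so some pair among \<open>2d + 1\<close> is \<open>\<epsilon>\<close>-close at every time; for generic
  small \<open>\<epsilon>\<close> the \<open>4d + 2\<close> points can be driven to positions where all pairs are far apart,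
  a contradiction. Otherwise all exit directions make an acute angle, bounded away from a right
  angle, with some \<open>v\<close>. Then the set of times at which a pair is close can be extended across fronts
  moving in direction \<open>v\<close>, and a family of growing ellipsoids adapted to the dilations of the Heisenberg
  group shows that a fixed finite set of times controls a translate of any finite set. By the
  pigeonhole principle some pair in different central orbits is then never separated.
\<close>

section \<open>Moving fronts in the Heisenberg group\<close>

text \<open>\<open>inner x (symp y)\<close> is the standard symplectic form; on horizontal parts it
  gives the central coordinate of the commutator.\<close>

definition symp :: "'b::real_inner \<times> 'b \<Rightarrow> 'b \<times> 'b" where
  "symp x = (snd x, - fst x)"

lemma symp_simps:
  "symp (x + y) = symp x + symp y" "symp (x - y) = symp x - symp y"
  "symp (c *\<^sub>R x) = c *\<^sub>R symp x"
  by (simp_all add: symp_def)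

lemma inner_symp_symp [simp]: "inner (symp x) (symp y) = inner x y"
  by (simp add: symp_def inner_prod_def)

lemma inner_symp_left: "inner (symp x) y = - inner x (symp y)"
  by (simp add: symp_def inner_prod_def)

lemma inner_symp_self [simp]: "inner x (symp x) = 0" "inner (symp x) x = 0"
  by (simp_all add: symp_def inner_prod_def inner_commute)

lemma norm_symp [simp]: "norm (symp x) = norm x"
  by (simp add: norm_eq_sqrt_inner)

text \<open>The vector \<open>m\<close> is half the horizontal gradient, at a boundary point, of the function
  \<open>body\<close> below. The ellipsoid is skewed so that at the characteristic points, where the gradient
  would vanish, the boundary is not advancing; on the advancing part the gradient is therefore
  bounded away from \<open>0\<close> and almost points forward.\<close>

lemma front_normal:
  fixes v y :: "'b::real_inner \<times> 'b" and E \<eta> :: real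
  defines "m \<equiv> y + E *\<^sub>R ((1/4) *\<^sub>R symp v + (1/2) *\<^sub>R symp y)"
  assumes v: "norm v = 1" and \<eta>: "0 < \<eta>" "\<eta> \<le> 1/32"
    and Q: "(norm y)\<^sup>2 + E\<^sup>2 / 32 = \<eta>\<^sup>2"
    and front: "0 \<le> inner y v + (norm y)\<^sup>2 + E\<^sup>2 / 16 + E * inner y (symp v) / 4"
  shows "\<eta>\<^sup>2 / 11 \<le> norm m" and "- 20 * \<eta> * norm m \<le> inner m v"
proof -
  define M Y where "M = norm m" and "Y = inner y (symp v)"
  have pos: "0 \<le> E\<^sup>2" "0 \<le> (norm y)\<^sup>2" by simp_all
  have "(norm y)\<^sup>2 \<le> \<eta>\<^sup>2" using Q pos by linarith
  then have y: "norm y \<le> \<eta>" using \<eta>(1) by (intro power2_le_imp_le[of "norm y" \<eta>]) auto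
  have "E\<^sup>2 \<le> 36 * \<eta>\<^sup>2" using Q pos by linarith
  then have "E\<^sup>2 \<le> (6 * \<eta>)\<^sup>2" by (simp add: power_mult_distrib)
  then have E: "\<bar>E\<bar> \<le> 6 * \<eta>" using \<eta>(1) by (intro power2_le_imp_le[of "\<bar>E\<bar>" "6 * \<eta>"]) auto
  have vv: "inner v v = 1" using v by (simp add: norm_eq_1)
  have yv: "\<bar>inner y v\<bar> \<le> \<eta>" using Cauchy_Schwarz_ineq2[of y v] v y by simp
  have mv: "inner m v = inner y v - E * Y / 2"
    by (simp add: m_def Y_def inner_simps inner_symp_left algebra_simps)
  have mJ: "inner m (symp v) = Y + E / 4 + E / 2 * inner y v"
    by (simp add: m_def Y_def inner_simps vv algebra_simps)
  have mJM: "\<bar>inner m (symp v)\<bar> \<le> M"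
    using Cauchy_Schwarz_ineq2[of m "symp v"] v by (simp add: M_def)
  have M0: "0 \<le> M" by (simp add: M_def)
  have nE: "norm (E *\<^sub>R ((1/4) *\<^sub>R symp v + (1/2) *\<^sub>R symp y)) \<le> \<bar>E\<bar> * (1/4 + \<eta>/2)"
  proof -
    have "norm ((1/4) *\<^sub>R symp v + (1/2) *\<^sub>R symp y) \<le> 1/4 + \<eta>/2"
      using norm_triangle_ineq[of "(1/4) *\<^sub>R symp v" "(1/2) *\<^sub>R symp y"] v y by simp
    then show ?thesis by (simp add: mult_left_mono)
  qed
  have e1: "\<bar>E\<bar> * (1/4 + \<eta>/2) \<le> 6 * \<eta> * (1/3)"
    using E \<eta> by (intro mult_mono) auto
  have M6: "M \<le> 3 * \<eta>"
    using norm_triangle_ineq[of y "E *\<^sub>R ((1/4) *\<^sub>R symp v + (1/2) *\<^sub>R symp y)"] nE e1 y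
    by (simp add: M_def m_def)
  \<comment> \<open>Since \<open>y\<close> is \<open>m\<close> minus its \<open>E\<close> term,
    \<open>(norm y)^2\<close> is at most \<open>E^2 / 16\<close> up to errors carrying a factor
    \<open>\<eta>\<close>.\<close>
  have "norm y \<le> M + \<bar>E\<bar> * (1/4 + \<eta>/2)"
    using norm_triangle_ineq4[of m "E *\<^sub>R ((1/4) *\<^sub>R symp v + (1/2) *\<^sub>R symp y)"] nE
    by (simp add: M_def m_def)
  then have "(norm y)\<^sup>2 \<le> (M + \<bar>E\<bar> * (1/4 + \<eta>/2))\<^sup>2"
    by (simp add: power_mono)
  also have "\<dots> = M * (M + 2 * (\<bar>E\<bar> * (1/4 + \<eta>/2))) + E\<^sup>2 * (1/4 + \<eta>/2)\<^sup>2"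
    by (simp add: power2_eq_square algebra_simps)
  also have "\<dots> \<le> M * (15 * \<eta>) + E\<^sup>2 * (1/16 + \<eta>/2)"
  proof (intro add_mono mult_left_mono)
    have "(1/4 + \<eta>/2)\<^sup>2 = 1/16 + \<eta> * (1/4 + \<eta>/4)" by (simp add: power2_eq_square algebra_simps)
    also have "\<dots> \<le> 1/16 + \<eta> * (1/2)" using \<eta> by (intro add_left_mono mult_left_mono) auto
    finally show "(1/4 + \<eta>/2)\<^sup>2 \<le> 1/16 + \<eta>/2" by simp
  qed (use M6 e1 M0 \<eta> in auto)
  finally have y2: "(norm y)\<^sup>2 \<le> 15 * \<eta> * M + E\<^sup>2 / 16 + E\<^sup>2 * \<eta> / 2"
    by (simp add: algebra_simps)
  have Y: "Y = inner m (symp v) - E / 4 - E / 2 * inner y v" using mJ by simp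
  have "E * Y * (3/4) = E * inner m (symp v) * (3/4) - 3/16 * E\<^sup>2 - 3/8 * E\<^sup>2 * inner y v"
    unfolding Y by (simp add: power2_eq_square algebra_simps)
  also have "\<dots> \<le> 6 * \<eta> * M * (3/4) - 3/16 * E\<^sup>2 + 3/8 * E\<^sup>2 * \<eta>"
  proof -
    have "E * inner m (symp v) \<le> \<bar>E\<bar> * \<bar>inner m (symp v)\<bar>" by (metis abs_ge_self abs_mult)
    also have "\<dots> \<le> 6 * \<eta> * M" using E mJM \<eta> by (intro mult_mono) auto
    finally have "E * inner m (symp v) \<le> 6 * \<eta> * M" .
    moreover have "E\<^sup>2 * (- inner y v) \<le> E\<^sup>2 * \<eta>" using yv by (intro mult_left_mono) auto
    ultimately show ?thesis by (simp add: algebra_simps)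
  qed
  finally have EY: "E * Y * (3/4) \<le> 5 * \<eta> * M - 3/16 * E\<^sup>2 + 3/8 * E\<^sup>2 * \<eta>"
    using mult_nonneg_nonneg[of \<eta> M] \<eta> M0 by linarith
  have Eeta: "E\<^sup>2 * \<eta> \<le> E\<^sup>2 * (1/32)" using \<eta> by (intro mult_left_mono) auto
  have "inner m v \<ge> - (norm y)\<^sup>2 - E\<^sup>2/16 - E * Y * (3/4)"
    using front mv by (simp add: Y_def)
  \<comment> \<open>To leading order the \<open>E^2\<close> terms sum to
    \<open>-1/16 - 1/16 + 3/16 = 1/16\<close>; half of this survives the errors of size
    \<open>E^2 * \<eta>\<close>.\<close>
  then have main: "inner m v \<ge> E\<^sup>2 / 32 - 20 * (\<eta> * M)"
  proof -
    have lin: "a \<ge> c/32 - 20 * h" if "a \<ge> - n - c/16 - z" "n \<le> 15 * h + c/16 + d/2"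
      "z \<le> 5 * h - 3/16 * c + 3/8 * d" "d \<le> c * (1/32)" "0 \<le> c" for a c h n z d :: real
      using that by linarith
    show ?thesis
      by (rule lin[where n = "(norm y)\<^sup>2" and z = "E * Y * (3/4)" and d = "E\<^sup>2 * \<eta>"])
        (use y2 EY Eeta pos(1) \<open>inner m v \<ge> - (norm y)\<^sup>2 - E\<^sup>2/16 - E * Y * (3/4)\<close>
          in \<open>simp_all add: mult.assoc\<close>)
  qed
  then have "- 20 * (\<eta> * M) \<le> inner m v" using pos by linarith
  then show "- 20 * \<eta> * norm m \<le> inner m v" by (simp add: M_def mult.assoc)
  \<comment> \<open>By \<open>main\<close> and Cauchy-Schwarz \<open>E^2\<close> is at most a
    multiple of \<open>M\<close>, and by \<open>y2\<close> so is \<open>(norm y)^2\<close>;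
    \<open>Q\<close> then bounds \<open>M\<close> from below.\<close>
  have eM: "\<eta> * M \<le> M * (1/32)" using \<eta> M0 mult_right_mono[of \<eta> "1/32" M] by simp
  have "inner m v \<le> M" using Cauchy_Schwarz_ineq2[of m v] v by (simp add: M_def)
  with main eM pos have "E\<^sup>2 \<le> 64 * M" using M0 by linarith
  then have "\<eta>\<^sup>2 \<le> 11 * M" using Q y2 Eeta eM M0 unfolding mult.assoc by linarith
  then show "\<eta>\<^sup>2 / 11 \<le> norm m" by (simp add: M_def)
qed

section \<open>Integer points in symmetrised coordinates\<close>

abbreviation heis_mult (infixl "\<star>" 70) where
  "g \<star> h \<equiv> g \<otimes>\<^bsub>heisenberg_group\<^esub> h"

definition hor :: "('d::finite) heisenberg \<Rightarrow> (real ^ 'd) \<times> (real ^ 'd)" where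
  "hor = (\<lambda>(v, u, t). (\<chi> i. of_int (v $ i), \<chi> i. of_int (u $ i)))"

text \<open>The central coordinate is symmetrised, so that the product only involves the symplectic
  form on horizontal parts.\<close>

definition ht :: "('d::finite) heisenberg \<Rightarrow> real" where
  "ht = (\<lambda>(v, u, t). of_int t - (\<Sum>i\<in>UNIV. of_int (v $ i) * of_int (u $ i)) / 2)"

lemma hor_mult [simp]: "hor (g \<star> h) = hor g + hor h"
  by (cases g; cases h) (simp add: hor_def heisenberg_group_def vec_eq_iff)

lemma ht_mult: "ht (g \<star> h) = ht g + ht h + inner (hor g) (symp (hor h)) / 2"
  by (cases g; cases h)
    (simp add: hor_def ht_def symp_def heisenberg_group_def inner_prod_def inner_vec_def
      sum.distrib field_simps sum_subtractf sum_negf)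

lemma finite_vec_bounded: "finite {x :: int ^ 'n::finite. \<forall>i. \<bar>x $ i\<bar> \<le> N}"
proof -
  have "{x :: int ^ 'n. \<forall>i. \<bar>x $ i\<bar> \<le> N} \<subseteq> vec_lambda ` (PiE UNIV (\<lambda>_. {- N..N}))"
  proof
    fix x :: "int ^ 'n" assume "x \<in> {x. \<forall>i. \<bar>x $ i\<bar> \<le> N}"
    then have "vec_nth x \<in> PiE UNIV (\<lambda>_. {- N..N})" by (auto simp: abs_le_iff minus_le_iff)
    then show "x \<in> vec_lambda ` (PiE UNIV (\<lambda>_. {- N..N}))"
      by (metis image_eqI vec_nth_inverse)
  qed
  then show ?thesis by (rule finite_subset) (intro finite_imageI finite_PiE, auto)
qed

text \<open>Bounded horizontal parts leave finitely many integer vectors, and for each choice a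
  bound on \<open>ht\<close> confines \<open>t\<close> to an interval.\<close>

lemma finite_heis_bounded: "finite {g :: ('d::finite) heisenberg. norm (hor g) \<le> r \<and> \<bar>ht g\<bar> \<le> s}"
proof -
  define N where "N = \<lceil>r\<rceil>"
  define A where "A = {x :: int ^ 'd. \<forall>i. \<bar>x $ i\<bar> \<le> N}"
  define \<beta> where "\<beta> = (\<lambda>(v :: int ^ 'd) (u :: int ^ 'd). (\<Sum>i\<in>UNIV. v $ i * u $ i))"
  have "{g :: 'd heisenberg. norm (hor g) \<le> r \<and> \<bar>ht g\<bar> \<le> s}
      \<subseteq> (\<Union>v\<in>A. \<Union>u\<in>A. (\<lambda>t. (v, u, t)) ` {\<lfloor>\<beta> v u / 2 - s\<rfloor>..\<lceil>\<beta> v u / 2 + s\<rceil>})"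
  proof
    fix g :: "'d heisenberg" assume g: "g \<in> {g. norm (hor g) \<le> r \<and> \<bar>ht g\<bar> \<le> s}"
    obtain v u t where vut: "g = (v, u, t)" by (cases g)
    have "\<bar>v $ i\<bar> \<le> N" "\<bar>u $ i\<bar> \<le> N" for i
    proof -
      have "norm (fst (hor g)) \<le> r" "norm (snd (hor g)) \<le> r"
        using g norm_fst_le[of "fst (hor g)" "snd (hor g)"]
          norm_snd_le[of "snd (hor g)" "fst (hor g)"] by auto
      then have "\<bar>fst (hor g) $ i\<bar> \<le> r" "\<bar>snd (hor g) $ i\<bar> \<le> r"
        using component_le_norm_cart order_trans by blast+
      then show "\<bar>v $ i\<bar> \<le> N" "\<bar>u $ i\<bar> \<le> N"
        by (simp_all add: vut hor_def N_def) linarith+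
    qed
    moreover have "t \<in> {\<lfloor>\<beta> v u / 2 - s\<rfloor>..\<lceil>\<beta> v u / 2 + s\<rceil>}"
    proof -
      have "ht g = t - \<beta> v u / 2" by (simp add: ht_def vut \<beta>_def)
      then have "\<beta> v u / 2 - s \<le> t" "t \<le> \<beta> v u / 2 + s" using g by auto
      then show ?thesis by (simp add: floor_le_iff le_ceiling_iff)
    qed
    ultimately show "g \<in> (\<Union>v\<in>A. \<Union>u\<in>A. (\<lambda>t. (v, u, t)) ` {\<lfloor>\<beta> v u / 2 - s\<rfloor>..\<lceil>\<beta> v u / 2 + s\<rceil>})"
      unfolding vut A_def by blast
  qed
  moreover have "finite A" unfolding A_def by (rule finite_vec_bounded)
  then have "finite (\<Union>v\<in>A. \<Union>u\<in>A. (\<lambda>t. (v, u, t)) ` {\<lfloor>\<beta> v u / 2 - s\<rfloor>..\<lceil>\<beta> v u / 2 + s\<rceil>})"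
    by auto
  ultimately show ?thesis by (rule finite_subset)
qed

text \<open>Rounding down costs at most \<open>1\<close> per horizontal coordinate, and the central
  entry is chosen to cancel the symmetrising term of \<open>ht\<close> up to rounding.\<close>

lemma heis_approx:
  fixes x :: "(real ^ 'd) \<times> (real ^ 'd::finite)"
  obtains g :: "'d heisenberg" where "norm (hor g - x) \<le> 2 * CARD('d)" "\<bar>ht g\<bar> \<le> 1"
proof -
  define v u where "v = (\<chi> i. \<lfloor>fst x $ i\<rfloor>)" and "u = (\<chi> i. \<lfloor>snd x $ i\<rfloor>)"
  define g where "g = (v, u, \<lfloor>(\<Sum>i\<in>UNIV. of_int (v $ i) * of_int (u $ i)) / 2 :: real\<rfloor>)"
  have *: "norm (y :: real ^ 'd) \<le> CARD('d)" if "\<And>i. \<bar>y $ i\<bar> \<le> 1" for y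
    using norm_le_l1_cart[of y] sum_bounded_above[of UNIV "\<lambda>i. \<bar>y $ i\<bar>" 1] that by auto
  have "norm (fst (hor g - x)) \<le> CARD('d)" "norm (snd (hor g - x)) \<le> CARD('d)"
    by (rule *; simp add: g_def hor_def v_def u_def; linarith)+
  then have "norm (hor g - x) \<le> 2 * CARD('d)"
    using norm_Pair_le[of "fst (hor g - x)" "snd (hor g - x)"] by (simp only: prod.collapse)
  moreover have "\<bar>ht g\<bar> \<le> 1" by (simp add: g_def ht_def) linarith
  ultimately show ?thesis by (rule that)
qed

section \<open>Growing bodies and front-closed sets\<close>

text \<open>\<open>K\<close> plays the role of the set of \<open>g\<close> that keep a given pair of points \<open>\<epsilon>\<close>-close. It absorbs a
  point \<open>g\<close> as soon as it contains a translated half-ball at \<open>g\<close> whose outward normal \<open>n\<close> points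
  at most slightly backwards with respect to \<open>v\<close>.\<close>

definition front_closed where
  "front_closed \<rho> b v K \<longleftrightarrow>
     (\<forall>g n. norm n = 1 \<longrightarrow> - b \<le> inner n v \<longrightarrow>
        (\<forall>f. norm (hor f) \<le> \<rho> \<longrightarrow> \<bar>ht f\<bar> \<le> \<rho> \<longrightarrow> inner n (hor f) < - 1 / \<rho> \<longrightarrow> f \<star> g \<in> K)
        \<longrightarrow> g \<in> K)"

text \<open>With \<open>s = 1 / r\<close>, the sublevel sets of \<open>body v r\<close> are the dilates by \<open>s\<close> of a small
  ellipsoid centred at \<open>v\<close>. They travel in direction \<open>v\<close> and grow as \<open>r\<close> decreases to \<open>0\<close>.\<close>

definition body where
  "body v r g = (norm (r *\<^sub>R hor g - v))\<^sup>2
     + 32 * (r\<^sup>2 * ht g - r * inner (hor g) (symp v) / 4)\<^sup>2"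

lemma body_eq:
  "body v r g = r\<^sup>2 * (norm (hor g))\<^sup>2 - 2 * r * inner (hor g) v + (norm v)\<^sup>2
     + 32 * (r\<^sup>2 * ht g - r * inner (hor g) (symp v) / 4)\<^sup>2"
  unfolding body_def power2_norm_eq_inner
  by (simp add: inner_diff_left inner_diff_right inner_commute power2_eq_square algebra_simps)

text \<open>\<open>r * D\<close> is the derivative in the logarithm of \<open>r\<close>. In terms of
  \<open>y\<close>, \<open>E\<close> and \<open>v\<close> it is twice the quantity that
  \<open>front_normal\<close> assumes nonnegative.\<close>

lemma body_has_derivative:
  fixes v :: "(real ^ 'd::finite) \<times> (real ^ 'd)" and g r
  defines "y \<equiv> r *\<^sub>R hor g - v"
    and "E \<equiv> 32 * (r\<^sup>2 * ht g - r * inner (hor g) (symp v) / 4)"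
  obtains D where "((\<lambda>r. body v r g) has_real_derivative D) (at r)"
    and "r * D = 2 * (inner y v + (norm y)\<^sup>2 + E\<^sup>2 / 16 + E * inner y (symp v) / 4)"
proof
  define w where "w = hor g"
  define D where "D = 2 * r * (norm w)\<^sup>2 - 2 * inner w v + 64 * (r\<^sup>2 * ht g - r * inner w (symp v) / 4) * (2 * r * ht g - inner w (symp v) / 4)"
  show "((\<lambda>r. body v r g) has_real_derivative D) (at r)"
    unfolding body_eq D_def w_def
    by (auto intro!: derivative_eq_intros simp: power2_eq_square algebra_simps)
  have ysym: "inner y (symp v) = r * inner w (symp v)"
    by (simp add: y_def w_def inner_diff_left)
  have y2: "inner y v + (norm y)\<^sup>2 = r\<^sup>2 * (norm w)\<^sup>2 - r * inner w v"
    unfolding power2_norm_eq_inner y_def w_def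
    by (simp add: inner_diff_left inner_diff_right inner_commute power2_eq_square algebra_simps)
  have "r * D = 2 * (r\<^sup>2 * (norm w)\<^sup>2 - r * inner w v + E\<^sup>2 / 16 + E * (r * inner w (symp v)) / 4)"
    unfolding D_def E_def w_def by (simp add: power2_eq_square field_simps)
  then show "r * D = 2 * (inner y v + (norm y)\<^sup>2 + E\<^sup>2 / 16 + E * inner y (symp v) / 4)"
    using ysym y2 by simp
qed

text \<open>An exact expansion: the term linear in \<open>hor f\<close> carries the vector
  \<open>m\<close> of \<open>front_normal\<close>, and all other increments have a factor
  \<open>r^2\<close>.\<close>

lemma body_mult:
  fixes v :: "(real ^ 'd::finite) \<times> (real ^ 'd)" and g f r
  defines "y \<equiv> r *\<^sub>R hor g - v"
    and "E \<equiv> 32 * (r\<^sup>2 * ht g - r * inner (hor g) (symp v) / 4)"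
  defines "q \<equiv> (1/4) *\<^sub>R symp v + (1/2) *\<^sub>R symp y"
  shows "body v r (f \<star> g) = body v r g + 2 * r * inner (y + E *\<^sub>R q) (hor f)
           + r\<^sup>2 * (norm (hor f))\<^sup>2 + 2 * E * r\<^sup>2 * ht f + 32 * (r * inner q (hor f) + r\<^sup>2 * ht f)\<^sup>2"
proof -
  define e where "e = r\<^sup>2 * ht g - r * inner (hor g) (symp v) / 4"
  have 1: "r *\<^sub>R hor (f \<star> g) - v = y + r *\<^sub>R hor f" by (simp add: y_def algebra_simps)
  have "(1/2) *\<^sub>R symp v = (1/4) *\<^sub>R symp v + (1/4) *\<^sub>R symp v"
    by (simp flip: scaleR_add_left)
  then have q: "q = (r / 2) *\<^sub>R symp (hor g) - (1/4) *\<^sub>R symp v"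
    by (simp add: q_def y_def symp_simps scaleR_diff_right)
  have "r\<^sup>2 * ht (f \<star> g) - r * inner (hor (f \<star> g)) (symp v) / 4
      = e + (r * inner q (hor f) + r\<^sup>2 * ht f)"
    by (simp add: q e_def ht_mult inner_simps inner_commute power2_eq_square algebra_simps)
  then have "body v r (f \<star> g)
      = (norm (y + r *\<^sub>R hor f))\<^sup>2 + 32 * (e + (r * inner q (hor f) + r\<^sup>2 * ht f))\<^sup>2"
    unfolding body_def 1 by simp
  moreover have "(norm (y + r *\<^sub>R hor f))\<^sup>2 = (norm y)\<^sup>2 + 2 * r * inner y (hor f) + r\<^sup>2 * (norm (hor f))\<^sup>2"
    unfolding power2_norm_eq_inner by (simp add: inner_simps inner_commute power2_eq_square algebra_simps)
  ultimately show ?thesis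
    unfolding body_def E_def e_def[symmetric] y_def[symmetric]
    by (simp add: inner_simps power2_eq_square algebra_simps)
qed

text \<open>\<open>0 \<le> D\<close> says that the front does not retreat at \<open>g\<close> as
  \<open>r\<close> decreases, so \<open>front_normal\<close> applies. For \<open>f\<close> well
  behind the normal the linear gain \<open>2 * r * \<eta>^2 / (11 * \<rho>)\<close> beats the
  remainder \<open>r^2 * (129 * \<rho>^2 + \<rho>)\<close>, whence the smallness condition on
  \<open>r\<close>.\<close>

lemma body_front:
  fixes v :: "(real ^ 'd::finite) \<times> (real ^ 'd)" and g r
  assumes v: "norm v = 1" and \<eta>: "0 < \<eta>" "\<eta> \<le> 1/32" and \<rho>: "0 < \<rho>"
    and r: "0 < r" "r \<le> 1" "r * (129 * \<rho>\<^sup>2 + \<rho>) < 2 * \<eta>\<^sup>2 / (11 * \<rho>)"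
    and body: "body v r g = \<eta>\<^sup>2"
    and D: "((\<lambda>r. body v r g) has_real_derivative D) (at r)" "0 \<le> D"
  obtains n where "norm n = 1" "- 20 * \<eta> \<le> inner n v"
    and "\<And>f. norm (hor f) \<le> \<rho> \<Longrightarrow> \<bar>ht f\<bar> \<le> \<rho> \<Longrightarrow> inner n (hor f) < - 1 / \<rho> \<Longrightarrow> body v r (f \<star> g) < \<eta>\<^sup>2"
proof -
  define y where "y = r *\<^sub>R hor g - v"
  define E where "E = 32 * (r\<^sup>2 * ht g - r * inner (hor g) (symp v) / 4)"
  define q where "q = (1/4) *\<^sub>R symp v + (1/2) *\<^sub>R symp y"
  define m where "m = y + E *\<^sub>R q"
  have Q: "(norm y)\<^sup>2 + E\<^sup>2 / 32 = \<eta>\<^sup>2"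
  proof -
    have "E\<^sup>2 / 32 = 32 * (r\<^sup>2 * ht g - r * inner (hor g) (symp v) / 4)\<^sup>2"
      unfolding E_def power_mult_distrib by simp
    then show ?thesis using body by (simp add: body_def y_def)
  qed
  obtain D' where D': "((\<lambda>r. body v r g) has_real_derivative D') (at r)"
    and rD': "r * D' = 2 * (inner y v + (norm y)\<^sup>2 + E\<^sup>2 / 16 + E * inner y (symp v) / 4)"
    using body_has_derivative[of v g r] unfolding y_def E_def by metis
  have "D' = D" using D(1) D' DERIV_unique by blast
  with rD' D(2) r(1) have front: "0 \<le> inner y v + (norm y)\<^sup>2 + E\<^sup>2 / 16 + E * inner y (symp v) / 4"
    by (metis mult_nonneg_nonneg less_imp_le zero_le_mult_iff not_numeral_le_zero linorder_not_le)
  have M: "\<eta>\<^sup>2 / 11 \<le> norm m" and mv: "- 20 * \<eta> * norm m \<le> inner m v"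
    using front_normal[OF v \<eta> Q front] by (auto simp: m_def q_def)
  have M0: "0 < norm m" using M \<eta>(1) zero_less_power[of \<eta> 2] by linarith
  have "(norm y)\<^sup>2 \<le> \<eta>\<^sup>2" "E\<^sup>2 \<le> 36 * \<eta>\<^sup>2" using Q zero_le_power2[of E] zero_le_power2[of "norm y"] by linarith+
  then have y: "norm y \<le> \<eta>" and E: "\<bar>E\<bar> \<le> 6 * \<eta>"
    using \<eta>(1) by (auto intro!: power2_le_imp_le[of "norm y" \<eta>] power2_le_imp_le[of "\<bar>E\<bar>" "6 * \<eta>"]
        simp: power_mult_distrib)
  have q: "norm q \<le> 1"
    using norm_triangle_ineq[of "(1/4) *\<^sub>R symp v" "(1/2) *\<^sub>R symp y"] v y \<eta> by (simp add: q_def)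
  show ?thesis
  proof (rule that[of "(1 / norm m) *\<^sub>R m"])
    show "norm ((1 / norm m) *\<^sub>R m) = 1" using M0 by simp
    show "- 20 * \<eta> \<le> inner ((1 / norm m) *\<^sub>R m) v" using mv M0 by (simp add: field_simps)
    fix f assume f: "norm (hor f) \<le> \<rho>" "\<bar>ht f\<bar> \<le> \<rho>" "inner ((1 / norm m) *\<^sub>R m) (hor f) < - 1 / \<rho>"
    have "inner m (hor f) < - norm m / \<rho>" using f(3) M0 by (simp add: field_simps)
    also have "\<dots> \<le> - (\<eta>\<^sup>2 / 11) / \<rho>" using M \<rho> by (intro divide_right_mono) auto
    finally have mf: "inner m (hor f) < - (\<eta>\<^sup>2 / (11 * \<rho>))" by simp
    have qf: "\<bar>inner q (hor f)\<bar> \<le> \<rho>"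
      using Cauchy_Schwarz_ineq2[of q "hor f"] mult_mono[OF q f(1)] by simp
    have "\<bar>r * inner q (hor f) + r\<^sup>2 * ht f\<bar> \<le> r * \<rho> + r * \<rho>"
    proof -
      have "\<bar>r * inner q (hor f)\<bar> \<le> r * \<rho>" using qf r by (simp add: abs_mult mult_left_mono)
      moreover have "\<bar>r\<^sup>2 * ht f\<bar> \<le> r * \<rho>"
        using f(2) r mult_mono[of "r\<^sup>2" r "\<bar>ht f\<bar>" \<rho>] by (simp add: abs_mult power2_eq_square mult_left_le)
      ultimately show ?thesis by linarith
    qed
    then have "\<bar>r * inner q (hor f) + r\<^sup>2 * ht f\<bar>\<^sup>2 \<le> (2 * (r * \<rho>))\<^sup>2"
      by (intro power_mono) (auto simp: mult.commute)
    then have "(r * inner q (hor f) + r\<^sup>2 * ht f)\<^sup>2 \<le> (2 * (r * \<rho>))\<^sup>2"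
      by (simp only: power2_abs)
    then have t3: "32 * (r * inner q (hor f) + r\<^sup>2 * ht f)\<^sup>2 \<le> r\<^sup>2 * (128 * \<rho>\<^sup>2)"
      by (simp add: power_mult_distrib mult_ac)
    have "(norm (hor f))\<^sup>2 \<le> \<rho>\<^sup>2" using f(1) by (simp add: power_mono)
    then have t1: "r\<^sup>2 * (norm (hor f))\<^sup>2 \<le> r\<^sup>2 * \<rho>\<^sup>2" by (simp add: mult_left_mono)
    have t2: "2 * E * r\<^sup>2 * ht f \<le> r\<^sup>2 * \<rho>"
    proof -
      have "\<bar>2 * E\<bar> * \<bar>ht f\<bar> \<le> 1 * \<rho>" using E \<eta> f(2) by (intro mult_mono) auto
      then have "2 * E * ht f \<le> \<rho>" by (metis abs_ge_self abs_mult mult_1 order_trans)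
      then have "r\<^sup>2 * (2 * E * ht f) \<le> r\<^sup>2 * \<rho>" by (intro mult_left_mono) auto
      then show ?thesis by (simp add: mult_ac)
    qed
    have "body v r (f \<star> g) = \<eta>\<^sup>2 + 2 * r * inner m (hor f)
        + r\<^sup>2 * (norm (hor f))\<^sup>2 + 2 * E * r\<^sup>2 * ht f + 32 * (r * inner q (hor f) + r\<^sup>2 * ht f)\<^sup>2"
      unfolding body_mult[of v r f g] body y_def[symmetric] E_def[symmetric] q_def[symmetric] m_def ..
    \<comment> \<open>Here \<open>129 = 1 + 32 * 2^2\<close>: the horizontal square contributes
      \<open>1\<close>, the square of the skewed central increment the rest.\<close>
    also have "\<dots> \<le> \<eta>\<^sup>2 + 2 * r * inner m (hor f) + r * (r * (129 * \<rho>\<^sup>2 + \<rho>))"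
    proof -
      have "r * (r * (129 * \<rho>\<^sup>2 + \<rho>)) = r\<^sup>2 * \<rho>\<^sup>2 + r\<^sup>2 * \<rho> + r\<^sup>2 * (128 * \<rho>\<^sup>2)"
        by (simp add: power2_eq_square algebra_simps)
      then show ?thesis using t1 t2 t3 by linarith
    qed
    also have "\<dots> < \<eta>\<^sup>2"
    proof -
      have "2 * inner m (hor f) + r * (129 * \<rho>\<^sup>2 + \<rho>) < 0" using mf r(3) by simp
      then have "r * (2 * inner m (hor f) + r * (129 * \<rho>\<^sup>2 + \<rho>)) < 0"
        using r(1) by (simp add: mult_pos_neg)
      then show ?thesis by (simp add: algebra_simps)
    qed
    finally show "body v r (f \<star> g) < \<eta>\<^sup>2" .
  qed
qed

text \<open>Undoing a rescaling by any \<open>r \<ge> s\<close> stays in one bounded box. Finiteness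
  of the whole union over \<open>r\<close> is what provides a largest contact parameter
  later.\<close>

lemma finite_bodies:
  fixes v :: "(real ^ 'd::finite) \<times> (real ^ 'd)"
  assumes v: "norm v = 1" and \<eta>: "0 < \<eta>" "\<eta> \<le> 1/32" and s: "0 < s"
  shows "finite {g. \<exists>r\<ge>s. body v r g \<le> \<eta>\<^sup>2}"
proof (rule finite_subset[OF _ finite_heis_bounded[of "2 / s" "2 / s\<^sup>2"]], safe)
  fix g r assume r: "s \<le> r" and g: "body v r g \<le> \<eta>\<^sup>2"
  define e where "e = r\<^sup>2 * ht g - r * inner (hor g) (symp v) / 4"
  have r0: "0 < r" using r s by simp
  have Q: "(norm (r *\<^sub>R hor g - v))\<^sup>2 + 32 * e\<^sup>2 \<le> \<eta>\<^sup>2" using g by (simp add: body_def e_def)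
  have "(norm (r *\<^sub>R hor g - v))\<^sup>2 \<le> \<eta>\<^sup>2" "e\<^sup>2 \<le> \<eta>\<^sup>2"
    using Q zero_le_power2[of e] zero_le_power2[of "norm (r *\<^sub>R hor g - v)"] by linarith+
  then have y: "norm (r *\<^sub>R hor g - v) \<le> \<eta>" and e: "\<bar>e\<bar> \<le> \<eta>"
    using \<eta>(1) power2_le_imp_le[of "norm (r *\<^sub>R hor g - v)" \<eta>] power2_le_imp_le[of "\<bar>e\<bar>" \<eta>]
    by auto
  have w: "norm (r *\<^sub>R hor g) \<le> 2" using norm_triangle_sub[of "r *\<^sub>R hor g" v] y v \<eta> by simp
  then have "r * norm (hor g) \<le> 2" using r0 by simp
  then have "s * norm (hor g) \<le> 2" using r mult_right_mono[OF r, of "norm (hor g)"] by simp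
  then show "norm (hor g) \<le> 2 / s" using s by (simp add: field_simps)
  have "\<bar>inner (r *\<^sub>R hor g) (symp v)\<bar> \<le> 2"
    using Cauchy_Schwarz_ineq2[of "r *\<^sub>R hor g" "symp v"] v w by simp
  moreover have "r\<^sup>2 * ht g = e + inner (r *\<^sub>R hor g) (symp v) / 4" by (simp add: e_def)
  ultimately have "\<bar>r\<^sup>2 * ht g\<bar> \<le> 2" using e \<eta> by linarith
  then have "r\<^sup>2 * \<bar>ht g\<bar> \<le> 2" by (simp add: abs_mult)
  moreover have "s\<^sup>2 * \<bar>ht g\<bar> \<le> r\<^sup>2 * \<bar>ht g\<bar>"
    using r s by (intro mult_right_mono power_mono abs_ge_zero) linarith+
  ultimately have "s\<^sup>2 * \<bar>ht g\<bar> \<le> 2" by linarith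
  then show "\<bar>ht g\<bar> \<le> 2 / s\<^sup>2" using s by (simp add: field_simps)
qed

lemma isCont_body: "isCont (\<lambda>r. body v r g) r"
  unfolding body_def by (intro continuous_intros) auto

lemma body_less_right:
  assumes "body v r g < c" "r < r0"
  obtains r' where "r < r'" "r' \<le> r0" "body v r' g < c"
proof -
  have "((\<lambda>r. body v r g) \<longlongrightarrow> body v r g) (at_right r)"
    using isCont_body[of r v g] by (simp add: isCont_def filterlim_at_split)
  then have "eventually (\<lambda>r'. body v r' g < c) (at_right r)" using assms(1) by (rule order_tendstoD)
  moreover have "eventually (\<lambda>r'. r' < r0) (at_right r)" using assms(2) by (rule eventually_at_right_real[THEN eventually_mono]) auto
  moreover have "eventually (\<lambda>r'. r < r') (at_right r)" by (simp add: eventually_at_filter)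
  ultimately have "eventually (\<lambda>r'. body v r' g < c \<and> r' < r0 \<and> r < r') (at_right r)"
    by eventually_elim simp
  then obtain r' where "body v r' g < c \<and> r' < r0 \<and> r < r'"
    using eventually_happens'[OF trivial_limit_at_right_real] by blast
  then show ?thesis using that[of r'] by simp
qed

text \<open>A point outside \<open>K\<close> that the bodies reach first, that is for the largest parameter, lies on
  the advancing part of the boundary and is absorbed.\<close>

lemma body_subset_front_closed:
  fixes v :: "(real ^ 'd::finite) \<times> (real ^ 'd)"
  assumes v: "norm v = 1" and \<eta>: "0 < \<eta>" "\<eta> \<le> 1/32" and \<rho>: "0 < \<rho>"
    and r0: "r0 \<le> 1" "r0 * (129 * \<rho>\<^sup>2 + \<rho>) < 2 * \<eta>\<^sup>2 / (11 * \<rho>)"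
    and K: "front_closed \<rho> (20 * \<eta>) v K" "{g. body v r0 g \<le> \<eta>\<^sup>2} \<subseteq> K"
    and r: "0 < r" "r \<le> r0" and g: "body v r g \<le> \<eta>\<^sup>2"
  shows "g \<in> K"
proof (rule ccontr)
  assume "g \<notin> K"
  \<comment> \<open>Time runs with decreasing \<open>r\<close>. Only finitely many points outside
    \<open>K\<close> are met, so the set \<open>A\<close> of contact parameters is compact and has a
    largest element \<open>s\<close>.\<close>
  define S where "S = {h. h \<notin> K \<and> (\<exists>r'\<in>{r..r0}. body v r' h \<le> \<eta>\<^sup>2)}"
  define A where "A = (\<Union>h\<in>S. {r'\<in>{r..r0}. body v r' h \<le> \<eta>\<^sup>2})"
  have "finite S" by (rule finite_subset[OF _ finite_bodies[OF v \<eta> r(1)]]) (auto simp: S_def)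
  moreover have "compact {r'\<in>{r..r0}. body v r' h \<le> \<eta>\<^sup>2}" for h
  proof -
    have "closed {r'. body v r' h \<le> \<eta>\<^sup>2}"
      by (intro closed_Collect_le continuous_at_imp_continuous_on ballI isCont_body continuous_on_const)
    then have "compact ({r..r0} \<inter> {r'. body v r' h \<le> \<eta>\<^sup>2})" by (intro compact_Int_closed) auto
    then show ?thesis by (simp add: Int_def)
  qed
  ultimately have "compact A" unfolding A_def by (intro compact_UN) auto
  moreover have "g \<in> S" using \<open>g \<notin> K\<close> g r unfolding S_def by fastforce
  then have "r \<in> A" using g r unfolding A_def by fastforce
  ultimately obtain s where s: "s \<in> A" "\<And>t. t \<in> A \<Longrightarrow> t \<le> s"
    using compact_attains_sup[of A] by blast
  then obtain h where h: "h \<notin> K" "r \<le> s" "s \<le> r0" "body v s h \<le> \<eta>\<^sup>2" by (auto simp: A_def S_def)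
  have inK: "h' \<in> K" if "s < r'" "r' \<le> r0" "body v r' h' \<le> \<eta>\<^sup>2" for h' r'
  proof (rule ccontr)
    assume "h' \<notin> K"
    then have "h' \<in> S" using that h r unfolding S_def by fastforce
    then have "r' \<in> A" using that h r unfolding A_def by fastforce
    then show False using s(2) that by force
  qed
  have "s \<noteq> r0" using h K(2) by auto
  then have s_less: "s < r0" using h by simp
  have eq: "body v s h = \<eta>\<^sup>2"
  proof (rule ccontr)
    assume "body v s h \<noteq> \<eta>\<^sup>2"
    then have "body v s h < \<eta>\<^sup>2" using h by simp
    then obtain r' where "s < r'" "r' \<le> r0" "body v r' h < \<eta>\<^sup>2" using s_less by (rule body_less_right)
    then show False using inK h(1) less_imp_le by blast
  qed
  obtain D where D: "((\<lambda>r. body v r h) has_real_derivative D) (at s)"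
    using body_has_derivative by blast
  \<comment> \<open>A negative derivative would put \<open>h\<close> into a body of larger
    parameter, which \<open>inK\<close> forbids.\<close>
  have "0 \<le> D"
  proof (rule ccontr)
    assume "\<not> 0 \<le> D"
    then obtain d where d: "d > 0" "\<And>x. 0 < x \<Longrightarrow> x < d \<Longrightarrow> body v (s + x) h < body v s h"
      using DERIV_neg_dec_right[OF D] by auto
    define x where "x = min (d / 2) (r0 - s)"
    have "0 < x" "x < d" "s + x \<le> r0" using d s_less by (auto simp: x_def)
    moreover have "body v (s + x) h \<le> \<eta>\<^sup>2" using d(2)[of x] eq \<open>0 < x\<close> \<open>x < d\<close> by simp
    ultimately show False using inK h(1) by (metis less_add_same_cancel1)
  qed
  have s1: "0 < s" "s \<le> 1" "s * (129 * \<rho>\<^sup>2 + \<rho>) < 2 * \<eta>\<^sup>2 / (11 * \<rho>)"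
  proof -
    show "0 < s" "s \<le> 1" using h r r0 by auto
    have "s * (129 * \<rho>\<^sup>2 + \<rho>) \<le> r0 * (129 * \<rho>\<^sup>2 + \<rho>)" using h \<rho> by (intro mult_right_mono) auto
    then show "s * (129 * \<rho>\<^sup>2 + \<rho>) < 2 * \<eta>\<^sup>2 / (11 * \<rho>)" using r0 by linarith
  qed
  obtain n where n: "norm n = 1" "- 20 * \<eta> \<le> inner n v"
    "\<And>f. norm (hor f) \<le> \<rho> \<Longrightarrow> \<bar>ht f\<bar> \<le> \<rho> \<Longrightarrow> inner n (hor f) < - 1 / \<rho> \<Longrightarrow> body v s (f \<star> h) < \<eta>\<^sup>2"
    using body_front[OF v \<eta> \<rho> s1 eq D \<open>0 \<le> D\<close>] by blast
  \<comment> \<open>Points strictly inside the body at \<open>s\<close> already lie in the body at a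
    slightly larger parameter, hence in \<open>K\<close>.\<close>
  have "f \<star> h \<in> K" if f: "norm (hor f) \<le> \<rho>" "\<bar>ht f\<bar> \<le> \<rho>" "inner n (hor f) < - 1 / \<rho>" for f
  proof -
    obtain r' where "s < r'" "r' \<le> r0" "body v r' (f \<star> h) < \<eta>\<^sup>2"
      using body_less_right[OF n(3)[OF f] s_less] by blast
    then show ?thesis using inK less_imp_le by blast
  qed
  then have "h \<in> K" using K(1) n(1,2) unfolding front_closed_def by (metis mult_minus_left)
  then show False using h by simp
qed

text \<open>Take \<open>h\<close> near \<open>v / r\<close> with bounded height. After rescaling it
  tends to \<open>v\<close>, where the body function vanishes because
  \<open>inner v (symp v) = 0\<close>; left multiplication by a fixed \<open>f\<close> changes the
  rescaled coordinates by a vanishing amount.\<close>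

lemma body_thick:
  fixes v :: "(real ^ 'd::finite) \<times> (real ^ 'd)"
  assumes F: "finite F" and \<eta>: "0 < \<eta>" and r0: "0 < r0"
  obtains r h where "0 < r" "r \<le> r0" "\<And>f. f \<in> F \<Longrightarrow> body v r (f \<star> h) \<le> \<eta>\<^sup>2"
proof -
  have "\<exists>h. norm (hor h - real (Suc k) *\<^sub>R v) \<le> 2 * CARD('d) \<and> \<bar>ht h\<bar> \<le> 1" for k
    using heis_approx[of "real (Suc k) *\<^sub>R v"] by blast
  then obtain h where h: "\<And>k. norm (hor (h k) - real (Suc k) *\<^sub>R v) \<le> 2 * CARD('d)" "\<And>k. \<bar>ht (h k)\<bar> \<le> 1"
    by metis
  define r where "r = (\<lambda>k. inverse (real (Suc k)))"
  have r: "r \<longlonglongrightarrow> 0" unfolding r_def by (rule LIMSEQ_inverse_real_of_nat)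
  have rpos: "0 < r k" for k by (simp add: r_def)
  have rSuc: "r k * real (Suc k) = 1" for k by (simp add: r_def)
  have lim: "(\<lambda>k. r k *\<^sub>R hor (h k)) \<longlonglongrightarrow> v"
  proof (rule LIM_zero_cancel, rule Lim_null_comparison)
    show "\<forall>\<^sub>F k in sequentially. norm (r k *\<^sub>R hor (h k) - v) \<le> r k * (2 * CARD('d))"
    proof (rule always_eventually, rule)
      fix k
      have "r k *\<^sub>R hor (h k) - v = r k *\<^sub>R (hor (h k) - real (Suc k) *\<^sub>R v)"
        using rSuc[of k] by (simp add: scaleR_diff_right del: of_nat_Suc)
      then show "norm (r k *\<^sub>R hor (h k) - v) \<le> r k * (2 * CARD('d))"
        using h(1)[of k] rpos[of k] by (simp add: mult_left_mono del: of_nat_Suc)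
    qed
    show "(\<lambda>k. r k * (2 * CARD('d))) \<longlonglongrightarrow> 0" using tendsto_mult_left_zero[OF r] .
  qed
  have lim2: "(\<lambda>k. (r k)\<^sup>2 * ht (h k)) \<longlonglongrightarrow> 0"
  proof (rule Lim_null_comparison)
    show "\<forall>\<^sub>F k in sequentially. norm ((r k)\<^sup>2 * ht (h k)) \<le> (r k)\<^sup>2"
      using h(2) by (simp add: abs_mult mult_left_le)
    show "(\<lambda>k. (r k)\<^sup>2) \<longlonglongrightarrow> 0" using tendsto_power[OF r, of 2] by simp
  qed
  have "(\<lambda>k. body v (r k) (f \<star> h k)) \<longlonglongrightarrow> 0" for f
  proof -
    have l1: "(\<lambda>k. r k *\<^sub>R hor (f \<star> h k)) \<longlonglongrightarrow> v"
      using tendsto_add[OF tendsto_scaleR[OF r tendsto_const[of "hor f"]] lim]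
      by (simp add: scaleR_add_right)
    have l2: "(\<lambda>k. (r k)\<^sup>2 * ht (f \<star> h k)) \<longlonglongrightarrow> 0"
    proof -
      have "(\<lambda>k. (r k)\<^sup>2 * ht f + (r k)\<^sup>2 * ht (h k) - r k * (inner (symp (hor f)) (r k *\<^sub>R hor (h k)) / 2)) \<longlonglongrightarrow> 0\<^sup>2 * ht f + 0 - 0 * (inner (symp (hor f)) v / 2)"
        by (intro tendsto_intros r lim lim2) auto
      then show ?thesis
        by (simp add: ht_mult inner_symp_left power2_eq_square algebra_simps)
    qed
    have "(\<lambda>k. body v (r k) (f \<star> h k)) \<longlonglongrightarrow> (norm (v - v))\<^sup>2 + 32 * (0 - inner v (symp v) / 4)\<^sup>2"
      unfolding body_def inner_scaleR_left[symmetric] by (intro tendsto_intros l1 l2) auto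
    then show ?thesis by simp
  qed
  then have "\<forall>\<^sub>F k in sequentially. body v (r k) (f \<star> h k) < \<eta>\<^sup>2" for f
    by (rule order_tendstoD) (use \<eta> in simp)
  then have "\<forall>\<^sub>F k in sequentially. \<forall>f\<in>F. body v (r k) (f \<star> h k) < \<eta>\<^sup>2"
    using F by (simp add: eventually_ball_finite)
  moreover have "\<forall>\<^sub>F k in sequentially. r k < r0" using order_tendstoD(2)[OF r r0] .
  ultimately have "\<forall>\<^sub>F k in sequentially. (\<forall>f\<in>F. body v (r k) (f \<star> h k) < \<eta>\<^sup>2) \<and> r k < r0"
    by (rule eventually_conj)
  then obtain k where "(\<forall>f\<in>F. body v (r k) (f \<star> h k) < \<eta>\<^sup>2) \<and> r k < r0"
    using eventually_happens' sequentially_bot by blast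
  then show ?thesis using that[of "r k" "h k"] rpos by force
qed

text \<open>\<open>K0\<close> is the body at one small parameter, and \<open>h\<close> depends on
  \<open>F\<close> but not on \<open>K\<close>. In the application \<open>K\<close> comes from a
  pair of points found only after \<open>h\<close> is chosen.\<close>

lemma front_closed_thick:
  fixes v :: "(real ^ 'd::finite) \<times> (real ^ 'd)"
  assumes v: "norm v = 1" and b: "0 < b" and \<rho>: "0 < \<rho>"
  obtains K0 :: "'d heisenberg set" where "finite K0"
    and "\<And>F. finite F \<Longrightarrow> \<exists>h. \<forall>K f. front_closed \<rho> b v K \<longrightarrow> K0 \<subseteq> K \<longrightarrow> f \<in> F \<longrightarrow> f \<star> h \<in> K"
proof -
  \<comment> \<open>\<open>1/32\<close> is the range of \<open>front_normal\<close>;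
    \<open>b / 20\<close> brings its tolerance \<open>20 * \<eta>\<close> below
    \<open>b\<close>.\<close>
  define \<eta> where "\<eta> = min (1/32) (b / 20)"
  have \<eta>: "0 < \<eta>" "\<eta> \<le> 1/32" "20 * \<eta> \<le> b" using b by (auto simp: \<eta>_def)
  define c where "c = 2 * \<eta>\<^sup>2 / (11 * \<rho>)"
  define d where "d = 129 * \<rho>\<^sup>2 + \<rho>"
  have c: "0 < c" "0 < d" using \<eta> \<rho> by (simp_all add: c_def d_def add_pos_pos)
  \<comment> \<open>Half the critical value, because the smallness condition on the parameter is
    strict.\<close>
  define r0 where "r0 = min 1 (c / (2 * d))"
  have r0: "0 < r0" "r0 \<le> 1" using c by (auto simp: r0_def)
  have "r0 * d \<le> c / (2 * d) * d" using c by (intro mult_right_mono) (auto simp: r0_def)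
  also have "\<dots> < c" using c by simp
  finally have r0c: "r0 * d < c" .
  have mono: "front_closed \<rho> (20 * \<eta>) v K" if "front_closed \<rho> b v K" for K
    using that \<eta>(3) unfolding front_closed_def by (meson neg_le_iff_le order_trans)
  show ?thesis
  proof (rule that)
    show "finite {g. body v r0 g \<le> \<eta>\<^sup>2}"
      by (rule finite_subset[OF _ finite_bodies[OF v \<eta>(1,2) r0(1)]]) auto
    fix F :: "'d heisenberg set" assume "finite F"
    then obtain r h where rh: "0 < r" "r \<le> r0" "\<And>f. f \<in> F \<Longrightarrow> body v r (f \<star> h) \<le> \<eta>\<^sup>2"
      using body_thick[OF _ \<eta>(1) r0(1)] by blast
    show "\<exists>h. \<forall>K f. front_closed \<rho> b v K \<longrightarrow> {g. body v r0 g \<le> \<eta>\<^sup>2} \<subseteq> K \<longrightarrow> f \<in> F \<longrightarrow> f \<star> h \<in> K"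
      using body_subset_front_closed[OF v \<eta>(1,2) \<rho> r0(2) r0c[unfolded c_def d_def] mono _ rh(1,2) rh(3)]
      by blast
  qed
qed

section \<open>Systems with strong topological minimal self-joinings\<close>

definition cen :: "int \<Rightarrow> ('d::finite) heisenberg" where
  "cen n = (0, 0, n)"

lemma carrier_heis [simp]: "carrier heisenberg_group = UNIV"
  by (simp add: heisenberg_group_def)

lemma heis_mult_eq:
  "(v1, u1, t1) \<star> (v2, u2, t2) = (v1 + v2, u1 + u2, t1 + t2 + (\<Sum>i\<in>UNIV. v1 $ i * u2 $ i))"
  by (simp add: heisenberg_group_def)

lemma heis_one_eq: "\<one>\<^bsub>heisenberg_group\<^esub> = cen 0"
  by (simp add: heisenberg_group_def cen_def)

lemma cen_mult: "cen m \<star> cen n = cen (m + n)"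
  by (simp add: cen_def heis_mult_eq)

lemma cen_commute: "cen n \<star> g = g \<star> cen n"
  by (cases g) (simp add: cen_def heis_mult_eq)

lemma group_center_heis: "group_center heisenberg_group = range (cen :: int \<Rightarrow> ('d::finite) heisenberg)"
proof
  show "range cen \<subseteq> (group_center heisenberg_group :: 'd heisenberg set)"
    by (auto simp: group_center_def cen_commute)
  show "group_center heisenberg_group \<subseteq> (range cen :: 'd heisenberg set)"
  proof
    fix z :: "'d heisenberg" assume z: "z \<in> group_center heisenberg_group"
    obtain v u t where vut: "z = (v, u, t)" by (cases z)
    have comm: "z \<star> g = g \<star> z" for g using z by (simp add: group_center_def del: split_paired_All)
    \<comment> \<open>Commuting with a unit vector of one horizontal block reads off the coordinate
      of \<open>z\<close> in the other block.\<close>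
    have "u $ i = 0" "v $ i = 0" for i
      using comm[of "(axis i 1, 0, 0)"] comm[of "(0, axis i 1, 0)"]
      by (simp_all add: vut heis_mult_eq axis_def if_distrib if_distribR cong: if_cong)
    then have "z = cen t" by (simp add: vut cen_def vec_eq_iff)
    then show "z \<in> range cen" by simp
  qed
qed

locale heis_joinings = topological_dynamical_system heisenberg_group X T
  for X :: "'a::metric_space set" and T :: "('d::finite) heisenberg \<Rightarrow> 'a \<Rightarrow> 'a" +
  assumes joinings: "strong_TMSJ (4 * CARD('d) + 2) heisenberg_group X T"
begin

lemma T_in [simp]: "x \<in> X \<Longrightarrow> T g x \<in> X"
  using element_image[of g x] by simp

lemma T_mult: "x \<in> X \<Longrightarrow> T (g \<star> h) x = T g (T h x)"
  using composition_rule[of x g h] by simp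

lemma T_cen_0 [simp]: "x \<in> X \<Longrightarrow> T (cen 0) x = x"
  using id_eq_one by (metis heis_one_eq restrict_apply')

lemma T_cen_cen: "x \<in> X \<Longrightarrow> T (cen m) (T (cen n) x) = T (cen (m + n)) x"
  by (simp add: T_mult[symmetric] cen_mult)

lemma T_cen_commute: "x \<in> X \<Longrightarrow> T g (T (cen n) x) = T (cen n) (T g x)"
  by (simp add: T_mult[symmetric] cen_commute)

lemma T_inverse:
  obtains h where "\<And>x. x \<in> X \<Longrightarrow> T h (T g x) = x" "\<And>x. x \<in> X \<Longrightarrow> T g (T h x) = x"
proof -
  interpret G: group heisenberg_group by (rule group_heisenberg_group)
  have "inv\<^bsub>heisenberg_group\<^esub> g \<star> g = cen 0" "g \<star> inv\<^bsub>heisenberg_group\<^esub> g = cen 0"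
    by (simp_all add: heis_one_eq)
  then show ?thesis using that by (metis T_mult T_cen_0)
qed

lemma T_inj: "x \<in> X \<Longrightarrow> y \<in> X \<Longrightarrow> T g x = T g y \<Longrightarrow> x = y"
  using T_inverse[of g] by metis

lemma T_tendsto:
  assumes "(f \<longlongrightarrow> x) F" "x \<in> X" "\<And>n. f n \<in> X"
  shows "((\<lambda>n. T g (f n)) \<longlongrightarrow> T g x) F"
  using continuous_on_tendsto_compose[OF continuous_action[of g] assms(1,2)] assms(3) by simp

lemma infinite_X: "infinite X"
  using joinings by (simp add: strong_TMSJ_def)

text \<open>By \<open>group_center_heis\<close> this is lying on a common orbit of the
  centre.\<close>

definition zrel where "zrel x y \<longleftrightarrow> (\<exists>n. y = T (cen n) x)"

lemma zrel_refl: "x \<in> X \<Longrightarrow> zrel x x"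
  unfolding zrel_def by (rule exI[of _ 0]) simp

lemma zrel_sym: "x \<in> X \<Longrightarrow> zrel x y \<Longrightarrow> zrel y x"
  unfolding zrel_def by (metis T_cen_0 T_cen_cen add.left_inverse)

lemma zrel_trans: "x \<in> X \<Longrightarrow> zrel x y \<Longrightarrow> zrel y z \<Longrightarrow> zrel x z"
  unfolding zrel_def by (metis T_cen_cen)

lemma zrel_T: "x \<in> X \<Longrightarrow> y \<in> X \<Longrightarrow> zrel (T g x) (T g y) \<Longrightarrow> zrel x y"
  unfolding zrel_def by (metis T_cen_commute T_in T_inj)

text \<open>Density in the product becomes approximation on a finite set instead of an indexed
  family, so coinciding points can be merged beforehand.\<close>

lemma joinings_dense:
  assumes R: "finite R" "R \<subseteq> X" "card R \<le> 4 * CARD('d) + 2"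
    and unrel: "\<And>x y. x \<in> R \<Longrightarrow> y \<in> R \<Longrightarrow> x \<noteq> y \<Longrightarrow> \<not> zrel x y"
    and z: "\<And>r. r \<in> R \<Longrightarrow> z r \<in> X" and e: "0 < e"
  obtains g where "\<And>r. r \<in> R \<Longrightarrow> dist (T g r) (z r) < e"
proof (cases "R = {}")
  case False
  define k where "k = card R"
  obtain x where x: "bij_betw x {..<k} R"
    using ex_bij_betw_nat_finite[OF R(1)] by (auto simp: k_def atLeast0LessThan)
  have xR: "x i \<in> R" if "i < k" for i using x that by (auto simp: bij_betw_def)
  let ?C = "heisenberg_group\<lparr>carrier := group_center heisenberg_group\<rparr>"
  have orb: "orbit ?C T y = {T (cen n) y |n. True}" for y
    by (auto simp: orbit_def group_center_heis simp del: split_paired_Ex)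
  have "orbit ?C T (x i) \<noteq> orbit ?C T (x j)" if "i < k" "j < k" "i \<noteq> j" for i j
  proof
    assume eq: "orbit ?C T (x i) = orbit ?C T (x j)"
    have "x j \<in> orbit ?C T (x j)" using zrel_refl[of "x j"] xR that R unfolding orb zrel_def by auto
    then have "zrel (x i) (x j)" unfolding eq[symmetric] unfolding orb zrel_def by auto
    moreover have "x i \<noteq> x j" using x that by (auto simp: bij_betw_def inj_on_def)
    ultimately show False using unrel xR that by blast
  qed
  moreover have "1 \<le> k" "k \<le> 4 * CARD('d) + 2" using R False by (auto simp: k_def Suc_le_eq card_gt_0_iff)
  moreover have "x ` {..<k} \<subseteq> X" "inj_on x {..<k}" using x R by (auto simp: bij_betw_def)
  ultimately have dense: "product_topology (\<lambda>i. top_of_set X) {..<k} closure_of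
               {\<lambda>i\<in>{..<k}. T g (x i) | g. g \<in> carrier heisenberg_group} = ({..<k} \<rightarrow>\<^sub>E X)"
    using joinings unfolding strong_TMSJ_def by blast
  have "(\<lambda>i\<in>{..<k}. z (x i)) \<in> ({..<k} \<rightarrow>\<^sub>E X)" using z xR by auto
  moreover have "openin (product_topology (\<lambda>i. top_of_set X) {..<k}) (\<Pi>\<^sub>E i\<in>{..<k}. X \<inter> ball (z (x i)) e)"
    by (simp add: openin_PiE openin_open_Int)
  moreover have "(\<lambda>i\<in>{..<k}. z (x i)) \<in> (\<Pi>\<^sub>E i\<in>{..<k}. X \<inter> ball (z (x i)) e)" using z xR e by auto
  ultimately obtain g where "(\<lambda>i\<in>{..<k}. T g (x i)) \<in> (\<Pi>\<^sub>E i\<in>{..<k}. X \<inter> ball (z (x i)) e)"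
    unfolding dense[symmetric] in_closure_of by blast
  then have "T g (x i) \<in> X \<inter> ball (z (x i)) e" if "i < k" for i
    using that by (auto dest!: PiE_mem[of _ _ _ i])
  then have "dist (T g r) (z r) < e" if "r \<in> R" for r
    using that x by (auto simp: bij_betw_def dist_commute)
  then show ?thesis by (rule that)
qed (use that in auto)

lemma joinings_limit:
  assumes R: "finite R" "R \<subseteq> X" "card R \<le> 4 * CARD('d) + 2"
    and unrel: "\<And>x y. x \<in> R \<Longrightarrow> y \<in> R \<Longrightarrow> x \<noteq> y \<Longrightarrow> \<not> zrel x y"
    and z: "\<And>r. r \<in> R \<Longrightarrow> z r \<in> X"
  obtains g :: "nat \<Rightarrow> 'd heisenberg" where "\<And>r. r \<in> R \<Longrightarrow> (\<lambda>k. T (g k) r) \<longlonglongrightarrow> z r"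
proof -
  have "\<exists>g. \<forall>r\<in>R. dist (T g r) (z r) < inverse (real (Suc k))" for k
  proof -
    obtain g where "\<And>r. r \<in> R \<Longrightarrow> dist (T g r) (z r) < inverse (real (Suc k))"
      by (rule joinings_dense[OF R unrel z, where e = "inverse (real (Suc k))"]) auto
    then show ?thesis by blast
  qed
  then obtain g where g: "\<And>k r. r \<in> R \<Longrightarrow> dist (T (g k) r) (z r) < inverse (real (Suc k))" by metis
  have "(\<lambda>k. T (g k) r) \<longlonglongrightarrow> z r" if "r \<in> R" for r
    by (rule metric_tendsto_imp_tendsto[OF LIMSEQ_inverse_real_of_nat])
      (use g[OF that] in \<open>auto intro!: always_eventually less_imp_le\<close>)
  then show ?thesis by (rule that)
qed

lemma minimal_limit:
  assumes "x \<in> X" "y \<in> X"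
  obtains g :: "nat \<Rightarrow> 'd heisenberg" where "(\<lambda>k. T (g k) x) \<longlonglongrightarrow> y"
  using joinings_limit[of "{x}" "\<lambda>_. y"] assms by auto

lemma pair_limit:
  assumes "x \<in> X" "x' \<in> X" "\<not> zrel x x'" "y \<in> X" "y' \<in> X"
  obtains g :: "nat \<Rightarrow> 'd heisenberg" where "(\<lambda>k. T (g k) x) \<longlonglongrightarrow> y" "(\<lambda>k. T (g k) x') \<longlonglongrightarrow> y'"
proof -
  have ne: "x \<noteq> x'" using assms zrel_refl by auto
  have ne': "\<not> zrel x' x" using assms zrel_sym by blast
  obtain g :: "nat \<Rightarrow> 'd heisenberg"
    where g: "\<And>r. r \<in> {x, x'} \<Longrightarrow> (\<lambda>k. T (g k) r) \<longlonglongrightarrow> (if r = x then y else y')"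
    by (rule joinings_limit[of "{x, x'}" "\<lambda>r. if r = x then y else y'"])
      (use assms ne ne' in \<open>auto simp: card_insert_if\<close>)
  show ?thesis using that[of g] g[of x] g[of x'] ne by simp
qed

lemma pair_separated:
  assumes "x \<in> X" "x' \<in> X" "\<not> zrel x x'" "y \<in> X" "y' \<in> X" "e < dist y y'"
  obtains g where "e < dist (T g x) (T g x')"
proof -
  obtain g where "(\<lambda>k. T (g k) x) \<longlonglongrightarrow> y" "(\<lambda>k. T (g k) x') \<longlonglongrightarrow> y'"
    using pair_limit assms by blast
  then have "(\<lambda>k. dist (T (g k) x) (T (g k) x')) \<longlonglongrightarrow> dist y y'" by (rule tendsto_dist)
  then have "\<forall>\<^sub>F k in sequentially. e < dist (T (g k) x) (T (g k) x')"
    using assms(6) by (rule order_tendstoD)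
  then show ?thesis using that eventually_happens' sequentially_bot by blast
qed

section \<open>Freeness of the central action and infinitely many central orbits\<close>

text \<open>If \<open>T (cen m)\<close> had a fixed point it would be the identity by minimality. Then elements whose
  horizontal part is divisible by \<open>m\<close> commute with the action, hence map \<open>y\<close> into its central
  orbit, and the whole orbit of \<open>y\<close> is finite.\<close>

lemma T_cen_free_pos:
  assumes y: "y \<in> X" and m: "0 < m" shows "T (cen m) y \<noteq> y"
proof
  assume eq: "T (cen m) y = y"
  have id: "T (cen m) x = x" if x: "x \<in> X" for x
  proof -
    obtain g where g: "(\<lambda>k. T (g k) y) \<longlonglongrightarrow> x" using minimal_limit[OF y x] .
    have "(\<lambda>k. T (cen m) (T (g k) y)) \<longlonglongrightarrow> T (cen m) x" using T_tendsto[OF g x] y by simp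
    then have "(\<lambda>k. T (g k) y) \<longlonglongrightarrow> T (cen m) x" using y eq by (simp add: T_cen_commute[symmetric])
    then show ?thesis using g LIMSEQ_unique by blast
  qed
  have idn: "T (cen (m * int k)) x = x" if "x \<in> X" for x k
    by (induction k) (use that in \<open>simp_all add: id T_cen_cen[symmetric] distrib_left\<close>)
  have idz: "T (cen (m * k)) x = x" if x: "x \<in> X" for x k
  proof (cases k)
    case (neg n)
    have "T (cen (m * k)) x = T (cen (m * k)) (T (cen (m * int (Suc n))) x)" by (simp only: idn[OF x])
    also have "\<dots> = T (cen 0) x" using x unfolding T_cen_cen[OF x] by (simp add: neg algebra_simps)
    finally show ?thesis using x by simp
  qed (use idn x in simp)
  have cmod: "T (cen n) x = T (cen (n mod m)) x" if x: "x \<in> X" for x n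
  proof -
    have "T (cen n) x = T (cen (n mod m)) (T (cen (m * (n div m))) x)" using x by (simp add: T_cen_cen)
    then show ?thesis using idz x by simp
  qed
  define h where "h = (\<lambda>(v :: int ^ 'd) (u :: int ^ 'd). ((\<chi> i. m * v $ i, \<chi> i. m * u $ i, 0) :: 'd heisenberg))"
  \<comment> \<open>Commutators with \<open>h v u\<close> are central with coordinate divisible by
    \<open>m\<close>, hence act trivially.\<close>
  have hcomm: "T g (T (h v u) x) = T (h v u) (T g x)" if x: "x \<in> X" for g v u x
  proof -
    obtain v' u' t' where g: "g = (v', u', t')" by (cases g)
    have "g \<star> h v u = h v u \<star> g \<star> cen (m * ((\<Sum>i\<in>UNIV. v' $ i * u $ i) - (\<Sum>i\<in>UNIV. v $ i * u' $ i)))"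
      by (simp add: g h_def cen_def heis_mult_eq sum_distrib_left algebra_simps)
    then have "T (g \<star> h v u) x = T (h v u \<star> g) x" using idz x by (simp add: T_mult)
    then show ?thesis using x by (simp add: T_mult)
  qed
  \<comment> \<open>A pair in different central orbits could be driven to \<open>(y, z)\<close> for
    any \<open>z\<close>; but \<open>T (h v u)\<close> commutes with the action, so the first limit
    determines the second.\<close>
  have hz: "zrel y (T (h v u) y)" for v u
  proof (rule ccontr)
    assume n: "\<not> zrel y (T (h v u) y)"
    obtain z where z: "z \<in> X" "z \<noteq> T (h v u) y"
      using infinite_X by (metis finite.emptyI finite_insert finite_subset insertI1 subsetI)
    obtain g where g: "(\<lambda>k. T (g k) y) \<longlonglongrightarrow> y" "(\<lambda>k. T (g k) (T (h v u) y)) \<longlonglongrightarrow> z"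
      using pair_limit[OF y _ n y z(1)] y by auto
    have "(\<lambda>k. T (h v u) (T (g k) y)) \<longlonglongrightarrow> T (h v u) y" using T_tendsto[OF g(1)] y by simp
    then have "(\<lambda>k. T (g k) (T (h v u) y)) \<longlonglongrightarrow> T (h v u) y" using y by (simp add: hcomm)
    then show False using g(2) z(2) LIMSEQ_unique by blast
  qed
  define B where "B = {v :: int ^ 'd. \<forall>i. \<bar>v $ i\<bar> \<le> m}"
  define F where "F = (\<lambda>g. T g y) ` (B \<times> B \<times> {0..m})"
  have "T g y \<in> F" for g
  proof -
    obtain v u t where g: "g = (v, u, t)" by (cases g)
    \<comment> \<open>Division with remainder by \<open>m\<close>: the quotient part moves
      \<open>y\<close> within its central orbit by \<open>hz\<close>, and central coordinates count
      only modulo \<open>m\<close>, so finitely many images remain.\<close>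
    define v0 u0 where "v0 = (\<chi> i. v $ i mod m)" and "u0 = (\<chi> i. u $ i mod m)"
    define v1 u1 where "v1 = (\<chi> i. v $ i div m)" and "u1 = (\<chi> i. u $ i div m)"
    define s where "s = t - (\<Sum>i\<in>UNIV. v0 $ i * (m * u1 $ i))"
    have "g = (v0, u0, s) \<star> h v1 u1"
      by (simp add: g s_def h_def heis_mult_eq v0_def u0_def v1_def u1_def vec_eq_iff)
    moreover obtain n where "T (h v1 u1) y = T (cen n) y" using hz[of v1 u1] by (auto simp: zrel_def)
    ultimately have "T g y = T ((v0, u0, 0) \<star> cen s) (T (cen n) y)"
      using y by (simp add: T_mult cen_def heis_mult_eq)
    also have "\<dots> = T (v0, u0, 0) (T (cen (s + n)) y)" using y by (simp add: T_mult T_cen_cen)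
    also have "\<dots> = T (v0, u0, 0) (T (cen ((s + n) mod m)) y)" using cmod y by metis
    also have "\<dots> = T (v0, u0, (s + n) mod m) y"
      using y by (simp add: T_mult[symmetric] cen_def heis_mult_eq)
    finally show ?thesis
      using m pos_mod_sign[OF m] pos_mod_bound[OF m]
      by (force simp: F_def B_def v0_def u0_def less_imp_le)
  qed
  moreover have "finite F" unfolding F_def B_def by (intro finite_imageI finite_cartesian_product finite_vec_bounded) simp
  then have "closed F" by (rule finite_imp_closed)
  ultimately have "X \<subseteq> F"
    using minimal_limit[OF y] closed_sequentially by (metis subsetI)
  then show False using infinite_X \<open>finite F\<close> finite_subset by blast
qed

lemma T_cen_free: assumes "y \<in> X" "m \<noteq> 0" shows "T (cen m) y \<noteq> y"
proof (cases "0 < m")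
  case False
  then have "T (cen (- m)) y \<noteq> y" using T_cen_free_pos assms by simp
  then show ?thesis using T_cen_cen[of y "- m" m] assms by auto
qed (use T_cen_free_pos assms in blast)

text \<open>Otherwise nonzero powers of \<open>a\<close> and of \<open>b\<close> act on
  \<open>x\<close> like central elements. Their commutator is a nonzero central element that then
  fixes a point, against \<open>T_cen_free\<close>.\<close>

lemma infinitely_many_zrel_classes:
  obtains y :: "nat \<Rightarrow> 'a" where "\<And>i. y i \<in> X" "\<And>i j. i \<noteq> j \<Longrightarrow> \<not> zrel (y i) (y j)"
proof -
  obtain x where x: "x \<in> X" using infinite_X by (metis finite.emptyI ex_in_conv)
  \<comment> \<open>With the all-ones vector in \<open>a\<close>, the pairing with \<open>b\<close>
    is \<open>k * l\<close> whichever index \<open>undefined\<close> denotes.\<close>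
  define a where "a = (\<lambda>k. ((\<chi> i. k, 0, 0) :: 'd heisenberg))"
  define b where "b = (\<lambda>k. ((0, axis undefined k, 0) :: 'd heisenberg))"
  note witness = that
  show ?thesis
  proof (rule ccontr)
    assume not_thesis: "\<not> thesis"
    have power: "\<exists>k. k \<noteq> 0 \<and> zrel x (T (f k) x)" if f: "\<And>k l. f k \<star> f l = f (k + l)" for f :: "int \<Rightarrow> 'd heisenberg"
    proof -
      obtain i j where ij: "i \<noteq> j" "zrel (T (f (int i)) x) (T (f (int j)) x)"
        using witness[of "\<lambda>i. T (f (int i)) x"] not_thesis x T_in by blast
      have eq: "T (f (int j)) x = T (f (int i)) (T (f (int j - int i)) x)"
        using f[of "int i" "int j - int i"] x by (simp add: T_mult[symmetric])
      have "zrel x (T (f (int j - int i)) x)"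
        using ij x unfolding eq by (intro zrel_T[of x _ "f (int i)"]) auto
      then show ?thesis using ij by (intro exI[of _ "int j - int i"]) auto
    qed
    have ab: "a k \<star> a l = a (k + l)" "b k \<star> b l = b (k + l)" for k l
      by (auto simp: a_def b_def heis_mult_eq vec_eq_iff axis_def)
    obtain k l where k: "k \<noteq> 0" "zrel x (T (a k) x)" and l: "l \<noteq> 0" "zrel x (T (b l) x)"
      using power[of a] power[of b] ab by blast
    obtain m n where m: "T (a k) x = T (cen m) x" and n: "T (b l) x = T (cen n) x"
      using k l by (auto simp: zrel_def)
    have "(\<Sum>i\<in>UNIV. k * (if i = (undefined :: 'd) then l else 0)) = k * (l :: int)"
      by (simp add: sum_distrib_left[symmetric] sum.delta)
    then have "a k \<star> b l = b l \<star> a k \<star> cen (k * l)"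
      by (simp add: a_def b_def cen_def heis_mult_eq axis_def)
    then have "T (a k) (T (b l) x) = T (cen (k * l)) (T (b l) (T (a k) x))"
      using x by (simp add: T_mult[symmetric] cen_commute)
    moreover have "T (a k) (T (b l) x) = T (cen (m + n)) x" "T (b l) (T (a k) x) = T (cen (m + n)) x"
      using T_cen_commute[OF x, of "a k" n] T_cen_commute[OF x, of "b l" m] x
      by (simp_all add: m n T_cen_cen add.commute)
    ultimately have "T (cen (m + n)) x = T (cen (k * l)) (T (cen (m + n)) x)" by simp
    then show False using T_cen_free[of "T (cen (m + n)) x" "k * l"] x k l by simp
  qed
qed

section \<open>Exit directions\<close>

lemma compact_X: "compact X"
  by (rule compact_space)

text \<open>Both bounds on distances are non-strict, so they pass to limits. The identity lies
  outside the open half-space, so the two bounds are compatible.\<close>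

definition exit_pair where
  "exit_pair \<epsilon> \<xi> x x' \<longleftrightarrow> x \<in> X \<and> x' \<in> X \<and> \<epsilon> \<le> dist x x'
     \<and> (\<forall>g. 0 < inner \<xi> (hor g) \<longrightarrow> dist (T g x) (T g x') \<le> \<epsilon>)"

definition exit_dirs where
  "exit_dirs \<epsilon> = {\<xi>. norm \<xi> = 1 \<and> (\<exists>x x'. exit_pair \<epsilon> \<xi> x x')}"

text \<open>Extract a limit by compactness of the sphere and of \<open>X\<close>. An element
  strictly inside the limiting half-space lies in all late truncated half-spaces, so closeness there
  passes to the limit.\<close>

lemma exit_dirs_limit:
  fixes \<xi>s :: "nat \<Rightarrow> (real ^ 'd) \<times> (real ^ 'd)"
  assumes \<xi>s: "\<And>k. norm (\<xi>s k) = 1" and x: "\<And>k. x k \<in> X" "\<And>k. x' k \<in> X"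
    and sep: "\<And>k. \<epsilon> \<le> dist (x k) (x' k)"
    and close: "\<And>k g. norm (hor g) \<le> real (Suc k) \<Longrightarrow> \<bar>ht g\<bar> \<le> real (Suc k)
      \<Longrightarrow> 1 / real (Suc k) < inner (\<xi>s k) (hor g) \<Longrightarrow> dist (T g (x k)) (T g (x' k)) \<le> \<epsilon>"
  obtains \<xi> r where "strict_mono (r :: nat \<Rightarrow> nat)" "(\<xi>s \<circ> r) \<longlonglongrightarrow> \<xi>" "\<xi> \<in> exit_dirs \<epsilon>"
proof -
  have "compact (sphere (0 :: (real ^ 'd) \<times> (real ^ 'd)) 1 \<times> X \<times> X)"
    by (intro compact_Times compact_X compact_sphere)
  moreover have "(\<xi>s k, x k, x' k) \<in> sphere 0 1 \<times> X \<times> X" for k using \<xi>s x by simp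
  ultimately obtain p r where p: "p \<in> sphere 0 1 \<times> X \<times> X" "strict_mono (r :: nat \<Rightarrow> nat)"
    "((\<lambda>k. (\<xi>s k, x k, x' k)) \<circ> r) \<longlonglongrightarrow> p"
    unfolding compact_def by (metis (no_types, lifting))
  obtain \<xi> y y' where pd: "p = (\<xi>, y, y')" by (cases p)
  have y: "norm \<xi> = 1" "y \<in> X" "y' \<in> X" using p(1) by (auto simp: pd)
  have l: "(\<xi>s \<circ> r) \<longlonglongrightarrow> \<xi>" and lx: "(x \<circ> r) \<longlonglongrightarrow> y" "(x' \<circ> r) \<longlonglongrightarrow> y'"
    using tendsto_fst[OF p(3)] tendsto_fst[OF tendsto_snd[OF p(3)]] tendsto_snd[OF tendsto_snd[OF p(3)]]
    by (simp_all add: pd o_def)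
  have "\<epsilon> \<le> dist y y'"
    by (rule tendsto_lowerbound[OF tendsto_dist[OF lx]]) (use sep in simp_all)
  moreover have "dist (T g y) (T g y') \<le> \<epsilon>" if g: "0 < inner \<xi> (hor g)" for g
  proof -
    have "(\<lambda>k. T g ((x \<circ> r) k)) \<longlonglongrightarrow> T g y" "(\<lambda>k. T g ((x' \<circ> r) k)) \<longlonglongrightarrow> T g y'"
      using T_tendsto[OF lx(1) y(2)] T_tendsto[OF lx(2) y(3)] x by simp_all
    then have lim: "(\<lambda>k. dist (T g (x (r k))) (T g (x' (r k)))) \<longlonglongrightarrow> dist (T g y) (T g y')"
      by (auto intro: tendsto_dist simp: o_def)
    have "(\<lambda>k. inner (\<xi>s (r k)) (hor g) - 1 / real (Suc (r k))) \<longlonglongrightarrow> inner \<xi> (hor g) - 0"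
    proof (rule tendsto_diff)
      show "(\<lambda>k. inner (\<xi>s (r k)) (hor g)) \<longlonglongrightarrow> inner \<xi> (hor g)"
        using l by (intro tendsto_inner tendsto_const) (simp add: o_def)
      show "(\<lambda>k. 1 / real (Suc (r k))) \<longlonglongrightarrow> 0"
        using LIMSEQ_subseq_LIMSEQ[OF LIMSEQ_inverse_real_of_nat p(2)] by (simp add: o_def inverse_eq_divide)
    qed
    then have "\<forall>\<^sub>F k in sequentially. 0 < inner (\<xi>s (r k)) (hor g) - 1 / real (Suc (r k))"
      using g by (intro order_tendstoD(1)[of _ "inner \<xi> (hor g) - 0"]) auto
    moreover have "\<forall>\<^sub>F k in sequentially. nat \<lceil>norm (hor g)\<rceil> \<le> k" "\<forall>\<^sub>F k in sequentially. nat \<lceil>\<bar>ht g\<bar>\<rceil> \<le> k"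
      by (rule eventually_ge_at_top)+
    ultimately have "\<forall>\<^sub>F k in sequentially. dist (T g (x (r k))) (T g (x' (r k))) \<le> \<epsilon>"
    proof eventually_elim
      case (elim k)
      have "k \<le> r k" using p(2) by (rule seq_suble)
      then have "norm (hor g) \<le> real (Suc (r k))" "\<bar>ht g\<bar> \<le> real (Suc (r k))"
        using elim by linarith+
      then show ?case using close elim by simp
    qed
    then show ?thesis by (rule tendsto_upperbound[OF lim]) simp
  qed
  ultimately have "\<xi> \<in> exit_dirs \<epsilon>" using y by (auto simp: exit_dirs_def exit_pair_def)
  then show ?thesis using that p(2) l by blast
qed

lemma compact_exit_dirs: "compact (exit_dirs \<epsilon>)"
  unfolding compact_def
proof (intro allI impI)
  fix \<xi>s :: "nat \<Rightarrow> (real ^ 'd) \<times> (real ^ 'd)"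
  assume "\<forall>n. \<xi>s n \<in> exit_dirs \<epsilon>"
  then obtain x x' where n: "\<And>k. norm (\<xi>s k) = 1" and p: "\<And>k. exit_pair \<epsilon> (\<xi>s k) (x k) (x' k)"
    unfolding exit_dirs_def mem_Collect_eq by metis
  have "0 < inner (\<xi>s k) (hor g)" if "1 / real (Suc k) < inner (\<xi>s k) (hor g)" for k g
    using that by (rule le_less_trans[rotated]) simp
  then show "\<exists>l\<in>exit_dirs \<epsilon>. \<exists>r. strict_mono r \<and> (\<xi>s \<circ> r) \<longlonglongrightarrow> l"
    using exit_dirs_limit[of \<xi>s x x' \<epsilon>] n p unfolding exit_pair_def by (metis (no_types, lifting))
qed

text \<open>If every integer \<open>\<rho>\<close> failed, there would be separated pairs staying
  close on ever larger truncated half-spaces with outward normals \<open>n k\<close>. A limit of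
  \<open>- n k\<close> is then an exit direction with \<open>inner v \<xi> \<le> b\<close>, against
  the assumption.\<close>

lemma exit_rule:
  assumes v: "\<And>\<xi>. \<xi> \<in> exit_dirs \<epsilon> \<Longrightarrow> b < inner v \<xi>"
  obtains \<rho> where "0 < \<rho>"
    and "\<And>x x'. x \<in> X \<Longrightarrow> x' \<in> X \<Longrightarrow> front_closed \<rho> b v {g. dist (T g x) (T g x') \<le> \<epsilon>}"
proof -
  have "\<exists>k. \<forall>n x x'. norm n = 1 \<longrightarrow> - b \<le> inner n v \<longrightarrow> x \<in> X \<longrightarrow> x' \<in> X \<longrightarrow>
      (\<forall>f. norm (hor f) \<le> real (Suc k) \<longrightarrow> \<bar>ht f\<bar> \<le> real (Suc k) \<longrightarrow> inner n (hor f) < - 1 / real (Suc k)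
        \<longrightarrow> dist (T f x) (T f x') \<le> \<epsilon>) \<longrightarrow> dist x x' \<le> \<epsilon>" (is "\<exists>k. ?P k")
  proof (rule ccontr)
    assume "\<not> ?thesis"
    then have "\<forall>k. \<exists>n x x'. norm n = 1 \<and> - b \<le> inner n v \<and> x \<in> X \<and> x' \<in> X \<and>
      (\<forall>f. norm (hor f) \<le> real (Suc k) \<longrightarrow> \<bar>ht f\<bar> \<le> real (Suc k) \<longrightarrow> inner n (hor f) < - 1 / real (Suc k)
        \<longrightarrow> dist (T f x) (T f x') \<le> \<epsilon>) \<and> \<not> dist x x' \<le> \<epsilon>" by blast
    then obtain n x x' where n: "\<And>k. norm (n k) = 1" "\<And>k. - b \<le> inner (n k) v"
      and x: "\<And>k. x k \<in> X" "\<And>k. x' k \<in> X" "\<And>k. \<not> dist (x k) (x' k) \<le> \<epsilon>"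
      and c: "\<And>k f. norm (hor f) \<le> real (Suc k) \<Longrightarrow> \<bar>ht f\<bar> \<le> real (Suc k) \<Longrightarrow> inner (n k) (hor f) < - 1 / real (Suc k)
        \<Longrightarrow> dist (T f (x k)) (T f (x' k)) \<le> \<epsilon>"
      by metis
    obtain \<xi> r where \<xi>: "strict_mono (r :: nat \<Rightarrow> nat)" "((\<lambda>k. - n k) \<circ> r) \<longlonglongrightarrow> \<xi>" "\<xi> \<in> exit_dirs \<epsilon>"
      by (rule exit_dirs_limit[of "\<lambda>k. - n k" x x' \<epsilon>]) (use n x c in \<open>auto simp: less_imp_le not_le\<close>)
    have "(\<lambda>k. inner v (- n (r k))) \<longlonglongrightarrow> inner v \<xi>"
      using \<xi>(2) by (intro tendsto_inner tendsto_const) (simp add: o_def)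
    moreover have "inner v (- n (r k)) \<le> b" for k using n(2)[of "r k"] by (simp add: inner_commute)
    ultimately have "inner v \<xi> \<le> b" by (intro tendsto_upperbound[of _ "inner v \<xi>" sequentially]) auto
    then show False using v[OF \<xi>(3)] by simp
  qed
  then obtain k where k: "?P k" ..
  show ?thesis
  proof (rule that[of "real (Suc k)"])
    fix x x' assume x: "x \<in> X" "x' \<in> X"
    \<comment> \<open>Absorption at \<open>g\<close> is the fact \<open>k\<close> for the pair
      \<open>T g x\<close>, \<open>T g x'\<close>.\<close>
    show "front_closed (real (Suc k)) b v {g. dist (T g x) (T g x') \<le> \<epsilon>}"
      unfolding front_closed_def mem_Collect_eq
      using k x by (simp add: T_mult del: split_paired_All of_nat_Suc)
  qed simp
qed

section \<open>Closeness on finite sets and the hull of the exit directions\<close>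

lemma uniform_close:
  assumes "finite K" "0 < \<epsilon>"
  obtains \<delta> where "0 < \<delta>"
    "\<And>x x' g. x \<in> X \<Longrightarrow> x' \<in> X \<Longrightarrow> dist x x' < \<delta> \<Longrightarrow> g \<in> K \<Longrightarrow> dist (T g x) (T g x') \<le> \<epsilon>"
proof -
  have "\<exists>\<delta>>0. \<forall>x\<in>X. \<forall>x'\<in>X. dist x x' < \<delta> \<longrightarrow> (\<forall>g\<in>K. dist (T g x) (T g x') \<le> \<epsilon>)"
    using assms(1)
  proof (induction K rule: finite_induct)
    case empty
    show ?case by (rule exI[of _ 1]) simp
  next
    case (insert g K)
    then obtain \<delta>1 where 1: "0 < \<delta>1" "\<forall>x\<in>X. \<forall>x'\<in>X. dist x x' < \<delta>1 \<longrightarrow> (\<forall>g\<in>K. dist (T g x) (T g x') \<le> \<epsilon>)"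
      by blast
    have "uniformly_continuous_on X (T g)"
      by (intro compact_uniformly_continuous continuous_action compact_X) simp
    then obtain \<delta>2 where 2: "0 < \<delta>2" "\<forall>x\<in>X. \<forall>x'\<in>X. dist x' x < \<delta>2 \<longrightarrow> dist (T g x') (T g x) < \<epsilon>"
      using assms(2) unfolding uniformly_continuous_on_def by metis
    show ?case
      by (rule exI[of _ "min \<delta>1 \<delta>2"]) (use 1 2 in \<open>auto simp: less_imp_le\<close>)
  qed
  then show ?thesis using that by blast
qed

lemma pigeonhole_close:
  assumes "0 < \<delta>"
  obtains M :: nat where "\<And>y :: nat \<Rightarrow> 'a. (\<And>i. y i \<in> X) \<Longrightarrow> \<exists>i\<le>M. \<exists>j\<le>M. i \<noteq> j \<and> dist (y i) (y j) < \<delta>"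
proof -
  obtain C where C: "finite C" "X \<subseteq> (\<Union>c\<in>C. ball c (\<delta>/2))"
    using compactE_image[OF compact_X, of X "\<lambda>c. ball c (\<delta>/2)"] assms
    by (metis UN_I centre_in_ball half_gt_zero open_ball subsetI)
  show ?thesis
  \<comment> \<open>The indices \<open>0\<close> to \<open>card C\<close> outnumber the balls by
    one.\<close>
  proof (rule that[of "card C"])
    fix y :: "nat \<Rightarrow> 'a" assume "\<And>i. y i \<in> X"
    then have "\<forall>i. \<exists>c\<in>C. dist c (y i) < \<delta>/2" using C by (simp add: subset_iff)
    then obtain c where c: "\<And>i. c i \<in> C" "\<And>i. dist (c i) (y i) < \<delta>/2" by metis
    have "card (c ` {..card C}) \<le> card C" using c C by (intro card_mono) auto
    then have "\<not> inj_on c {..card C}" using card_image[of c "{..card C}"] by auto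
    then obtain i j where "i \<le> card C" "j \<le> card C" "i \<noteq> j" "c i = c j" by (auto simp: inj_on_def)
    moreover have "dist (y i) (y j) < \<delta>"
      using c(2)[of i] c(2)[of j] \<open>c i = c j\<close> dist_triangle_half_r[of "c i" "y i" \<delta> "y j"] by simp
    ultimately show "\<exists>i\<le>card C. \<exists>j\<le>card C. i \<noteq> j \<and> dist (y i) (y j) < \<delta>" by blast
  qed
qed

text \<open>Otherwise the exit directions lie in an open half-space, and closeness on a fixed finite set
  spreads to translates of arbitrary finite sets. Among sufficiently many points two are
  \<open>\<delta>\<close>-close after applying any given group element, so some pair is never separated.\<close>

lemma zero_in_hull_exit_dirs:
  assumes \<epsilon>: "0 < \<epsilon>" and large: "z \<in> X" "z' \<in> X" "\<epsilon> < dist z z'"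
  shows "0 \<in> convex hull (exit_dirs \<epsilon>)"
proof (rule ccontr)
  assume "0 \<notin> convex hull (exit_dirs \<epsilon>)"
  then obtain a b where ab: "a \<noteq> 0" "0 < b" "\<And>\<xi>. \<xi> \<in> convex hull (exit_dirs \<epsilon>) \<Longrightarrow> b < inner a \<xi>"
    using separating_hyperplane_closed_0[of "convex hull (exit_dirs \<epsilon>)"]
    by (metis compact_convex_hull compact_exit_dirs compact_imp_closed convex_convex_hull)
  define v where "v = (1 / norm a) *\<^sub>R a"
  have v: "norm v = 1" using ab by (simp add: v_def)
  have vb: "0 < b / norm a" "\<And>\<xi>. \<xi> \<in> exit_dirs \<epsilon> \<Longrightarrow> b / norm a < inner v \<xi>"
    using ab hull_inc[of _ "exit_dirs \<epsilon>" convex] by (simp_all add: v_def divide_strict_right_mono)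
  obtain \<rho> where \<rho>: "0 < \<rho>"
    "\<And>x x'. x \<in> X \<Longrightarrow> x' \<in> X \<Longrightarrow> front_closed \<rho> (b / norm a) v {g. dist (T g x) (T g x') \<le> \<epsilon>}"
    using exit_rule[OF vb(2)] by blast
  obtain K0 where K0: "finite K0" and thick: "\<And>F :: 'd heisenberg set. finite F \<Longrightarrow>
      \<exists>h. \<forall>K f. front_closed \<rho> (b / norm a) v K \<longrightarrow> K0 \<subseteq> K \<longrightarrow> f \<in> F \<longrightarrow> f \<star> h \<in> K"
    using front_closed_thick[OF v vb(1) \<rho>(1)] by blast
  \<comment> \<open>\<open>K0\<close>, \<open>\<delta>\<close> and \<open>M\<close> are fixed before
    the points \<open>y\<close>; the separating times \<open>F\<close>, and then \<open>h\<close>,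
    may depend on all of them.\<close>
  obtain \<delta> where \<delta>: "0 < \<delta>" "\<And>x x' g. x \<in> X \<Longrightarrow> x' \<in> X \<Longrightarrow> dist x x' < \<delta> \<Longrightarrow> g \<in> K0 \<Longrightarrow> dist (T g x) (T g x') \<le> \<epsilon>"
    using uniform_close[OF K0 \<epsilon>] by blast
  obtain M where M: "\<And>y :: nat \<Rightarrow> 'a. (\<And>i. y i \<in> X) \<Longrightarrow> \<exists>i\<le>M. \<exists>j\<le>M. i \<noteq> j \<and> dist (y i) (y j) < \<delta>"
    using pigeonhole_close[OF \<delta>(1)] by blast
  obtain y :: "nat \<Rightarrow> 'a" where y: "\<And>i. y i \<in> X" "\<And>i j. i \<noteq> j \<Longrightarrow> \<not> zrel (y i) (y j)"
    using infinitely_many_zrel_classes by blast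
  have "\<exists>g. i \<noteq> j \<longrightarrow> \<epsilon> < dist (T g (y i)) (T g (y j))" for i j
    using pair_separated[OF y(1) y(1) y(2) large(1,2,3)] by metis
  then obtain g where g: "\<And>i j. i \<noteq> j \<Longrightarrow> \<epsilon> < dist (T (g i j) (y i)) (T (g i j) (y j))" by metis
  define F where "F = (\<lambda>(i, j). g i j) ` ({..M} \<times> {..M})"
  have "finite F" by (simp add: F_def)
  then obtain h where h: "\<And>K f. front_closed \<rho> (b / norm a) v K \<Longrightarrow> K0 \<subseteq> K \<Longrightarrow> f \<in> F \<Longrightarrow> f \<star> h \<in> K"
    using thick by blast
  \<comment> \<open>As \<open>k\<close> undoes \<open>h\<close>, the time
    \<open>g i j \<star> h\<close> takes \<open>T k (y i)\<close> to \<open>T (g i j) (y i)\<close>.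
    The pigeonhole is therefore applied to the points \<open>T k (y i)\<close>.\<close>
  obtain k where k: "\<And>x. x \<in> X \<Longrightarrow> T h (T k x) = x" using T_inverse[of h] by metis
  obtain i j where ij: "i \<le> M" "j \<le> M" "i \<noteq> j" "dist (T k (y i)) (T k (y j)) < \<delta>"
    using M[of "\<lambda>i. T k (y i)"] y by auto
  have "g i j \<star> h \<in> {g. dist (T g (T k (y i))) (T g (T k (y j))) \<le> \<epsilon>}"
  proof (rule h)
    show "front_closed \<rho> (b / norm a) v {g. dist (T g (T k (y i))) (T g (T k (y j))) \<le> \<epsilon>}"
      using \<rho>(2) y by simp
    show "K0 \<subseteq> {g. dist (T g (T k (y i))) (T g (T k (y j))) \<le> \<epsilon>}" using \<delta>(2) ij(4) y by auto
    show "g i j \<in> F" using ij by (auto simp: F_def)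
  qed
  then have "dist (T (g i j) (y i)) (T (g i j) (y j)) \<le> \<epsilon>" using k y by (simp add: T_mult)
  then show False using g[OF ij(3)] by simp
qed

section \<open>A generic scale and well-separated targets\<close>

text \<open>If \<open>x' = T (cen n) x\<close>, then closeness on a half-space spreads to the whole space by
  minimality, and \<open>\<epsilon>\<close> is the maximal displacement of \<open>T (cen n)\<close>. This excludes only countably
  many \<open>\<epsilon>\<close>.\<close>

lemma exit_pair_not_zrel:
  assumes pair: "exit_pair \<epsilon> \<xi> x x'" and \<xi>: "norm \<xi> = 1"
    and generic: "\<And>n. \<not> ((\<forall>z\<in>X. dist z (T (cen n) z) \<le> \<epsilon>) \<and> (\<exists>z\<in>X. dist z (T (cen n) z) = \<epsilon>))"
  shows "\<not> zrel x x'"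
proof
  assume "zrel x x'"
  then obtain n where n: "x' = T (cen n) x" by (auto simp: zrel_def)
  have x: "x \<in> X" and sep: "\<epsilon> \<le> dist x x'"
    and close: "\<And>g. 0 < inner \<xi> (hor g) \<Longrightarrow> dist (T g x) (T (cen n) (T g x)) \<le> \<epsilon>"
    using pair n T_cen_commute by (auto simp: exit_pair_def)
  \<comment> \<open>Going off in direction \<open>\<xi>\<close> brings \<open>g \<star> h k\<close>
    into the half-space for every fixed \<open>g\<close> and large \<open>k\<close>, so a limit
    \<open>z\<close> of the points \<open>T (h k) x\<close> obeys the displacement bound along its
    whole orbit.\<close>
  have "\<exists>h. norm (hor h - real k *\<^sub>R \<xi>) \<le> 2 * CARD('d)" for k
    using heis_approx[of "real k *\<^sub>R \<xi>"] by metis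
  then obtain h :: "nat \<Rightarrow> 'd heisenberg" where h: "\<And>k. norm (hor (h k) - real k *\<^sub>R \<xi>) \<le> 2 * CARD('d)"
    by metis
  obtain z r where z: "z \<in> X" "strict_mono (r :: nat \<Rightarrow> nat)" "((\<lambda>k. T (h k) x) \<circ> r) \<longlonglongrightarrow> z"
    using compact_X x T_in unfolding compact_def by metis
  have orbit: "dist (T g z) (T (cen n) (T g z)) \<le> \<epsilon>" for g
  proof (rule tendsto_upperbound)
    have "(\<lambda>k. T g (T (h (r k)) x)) \<longlonglongrightarrow> T g z" using T_tendsto[OF z(3,1), of g] x by simp
    then show "(\<lambda>k. dist (T g (T (h (r k)) x)) (T (cen n) (T g (T (h (r k)) x)))) \<longlonglongrightarrow> dist (T g z) (T (cen n) (T g z))"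
      using T_tendsto[of "\<lambda>k. T g (T (h (r k)) x)" "T g z" sequentially "cen n"] x z by (intro tendsto_dist) auto
    have "\<forall>\<^sub>F k in sequentially. nat \<lceil>2 * CARD('d) + norm (hor g)\<rceil> + 1 \<le> k" by (rule eventually_ge_at_top)
    then show "\<forall>\<^sub>F k in sequentially. dist (T g (T (h (r k)) x)) (T (cen n) (T g (T (h (r k)) x))) \<le> \<epsilon>"
    proof eventually_elim
      case (elim k)
      have "k \<le> r k" using z(2) by (rule seq_suble)
      then have big: "2 * CARD('d) + norm (hor g) < real (r k)" using elim by linarith
      have "inner \<xi> (hor (g \<star> h (r k))) = inner \<xi> (hor g) + inner \<xi> (hor (h (r k)) - real (r k) *\<^sub>R \<xi>) + real (r k)"
        using \<xi> by (simp add: inner_simps norm_eq_1)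
      moreover have "\<bar>inner \<xi> (hor g)\<bar> \<le> norm (hor g)" using Cauchy_Schwarz_ineq2[of \<xi> "hor g"] \<xi> by simp
      moreover have "\<bar>inner \<xi> (hor (h (r k)) - real (r k) *\<^sub>R \<xi>)\<bar> \<le> 2 * CARD('d)"
        using Cauchy_Schwarz_ineq2[of \<xi> "hor (h (r k)) - real (r k) *\<^sub>R \<xi>"] \<xi> h[of "r k"] by simp
      ultimately have "0 < inner \<xi> (hor (g \<star> h (r k)))" using big by linarith
      then show ?case using close[of "g \<star> h (r k)"] x by (simp add: T_mult)
    qed
  qed simp
  have "dist y (T (cen n) y) \<le> \<epsilon>" if y: "y \<in> X" for y
  proof -
    obtain g where g: "(\<lambda>k. T (g k) z) \<longlonglongrightarrow> y" using minimal_limit[OF z(1) y] .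
    have "(\<lambda>k. dist (T (g k) z) (T (cen n) (T (g k) z))) \<longlonglongrightarrow> dist y (T (cen n) y)"
      using g T_tendsto[OF g y, of "cen n"] z by (intro tendsto_dist) auto
    then show ?thesis by (rule tendsto_upperbound) (use orbit in auto)
  qed
  \<comment> \<open>The bound at \<open>x\<close> meets \<open>sep\<close>, so the displacement
    \<open>\<epsilon>\<close> is maximal and attained.\<close>
  then show False using generic[of n] sep x n by (metis order_antisym)
qed

text \<open>Freeness and compactness give a common lower bound \<open>c > 0\<close> for the
  displacements by \<open>cen 1\<close> to \<open>cen L\<close>. Below \<open>c / 2\<close> only
  countably many scales are bad, at most one for each \<open>n\<close>.\<close>

lemma generic_epsilon:
  fixes L :: nat
  obtains \<epsilon> where "0 < \<epsilon>"
    and "\<And>z i. z \<in> X \<Longrightarrow> 1 \<le> i \<Longrightarrow> i \<le> L \<Longrightarrow> 2 * \<epsilon> < dist (T (cen (int i)) z) z"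
    and "\<And>n. \<not> ((\<forall>z\<in>X. dist z (T (cen n) z) \<le> \<epsilon>) \<and> (\<exists>z\<in>X. dist z (T (cen n) z) = \<epsilon>))"
proof -
  have "\<exists>c>0. \<forall>z\<in>X. \<forall>i. 1 \<le> i \<and> i \<le> L \<longrightarrow> c \<le> dist (T (cen (int i)) z) z"
  proof (induction L)
    case 0
    show ?case by (rule exI[of _ 1]) simp
  next
    case (Suc L)
    then obtain c where c: "0 < c" "\<forall>z\<in>X. \<forall>i. 1 \<le> i \<and> i \<le> L \<longrightarrow> c \<le> dist (T (cen (int i)) z) z" by blast
    have "continuous_on X (\<lambda>z. dist (T (cen (int (Suc L))) z) z)"
      by (intro continuous_on_dist continuous_action continuous_on_id) simp
    moreover have "X \<noteq> {}" using infinite_X by auto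
    ultimately obtain w where w: "w \<in> X" "\<forall>z\<in>X. dist (T (cen (int (Suc L))) w) w \<le> dist (T (cen (int (Suc L))) z) z"
      using continuous_attains_inf[OF compact_X] by blast
    have "0 < dist (T (cen (int (Suc L))) w) w" using T_cen_free[OF w(1)] by simp
    then show ?case
      using c w by (intro exI[of _ "min c (dist (T (cen (int (Suc L))) w) w)"]) (auto simp: le_Suc_eq min_le_iff_disj)
  qed
  then obtain c where c: "0 < c" "\<And>z i. z \<in> X \<Longrightarrow> 1 \<le> i \<Longrightarrow> i \<le> L \<Longrightarrow> c \<le> dist (T (cen (int i)) z) z" by blast
  define bad where "bad = (\<lambda>n \<epsilon>. (\<forall>z\<in>X. dist z (T (cen n) z) \<le> \<epsilon>) \<and> (\<exists>z\<in>X. dist z (T (cen n) z) = \<epsilon>))"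
  have uniq: "\<epsilon> = \<epsilon>'" if "bad n \<epsilon>" "bad n \<epsilon>'" for n \<epsilon> \<epsilon>'
    using that unfolding bad_def by (metis order_antisym)
  \<comment> \<open>A bad scale is unique for its \<open>n\<close>, so the \<open>THE\<close>
    values, arbitrary for the other \<open>n\<close>, cover them all.\<close>
  have "{\<epsilon>. \<exists>n. bad n \<epsilon>} \<subseteq> range (\<lambda>n. THE \<epsilon>. bad n \<epsilon>)"
  proof
    fix \<epsilon> assume "\<epsilon> \<in> {\<epsilon>. \<exists>n. bad n \<epsilon>}"
    then obtain n where n: "bad n \<epsilon>" by blast
    then have "(THE \<epsilon>. bad n \<epsilon>) = \<epsilon>" using uniq by blast
    then show "\<epsilon> \<in> range (\<lambda>n. THE \<epsilon>. bad n \<epsilon>)" by (metis rangeI)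
  qed
  then have "countable {\<epsilon>. \<exists>n. bad n \<epsilon>}" by (rule countable_subset) simp
  moreover have "uncountable {0<..<c / 2}" using c by (simp add: uncountable_open_interval)
  ultimately have "\<not> {0<..<c / 2} \<subseteq> {\<epsilon>. \<exists>n. bad n \<epsilon>}" using countable_subset by blast
  then obtain \<epsilon> where "\<epsilon> \<in> {0<..<c / 2}" "\<And>n. \<not> bad n \<epsilon>" by blast
  then have \<epsilon>: "0 < \<epsilon>" "2 * \<epsilon> < c" and "\<And>n. \<not> bad n \<epsilon>" by auto
  show ?thesis
  proof (rule that[OF \<epsilon>(1)])
    show "2 * \<epsilon> < dist (T (cen (int i)) z) z" if "z \<in> X" "1 \<le> i" "i \<le> L" for z i
      using c(2)[OF that] \<epsilon>(2) by simp
  qed (use \<open>\<And>n. \<not> bad n \<epsilon>\<close> in \<open>simp add: bad_def\<close>)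
qed

text \<open>All targets are taken on one central orbit \<open>T (cen i) w\<close> with \<open>i \<le> L\<close>: each constraint
  forbids at most one value of \<open>i\<close>, so a greedy choice succeeds.\<close>

lemma separating_targets:
  fixes p q :: "'i \<Rightarrow> 'b" and m n :: "'i \<Rightarrow> int"
  assumes R: "finite R" and S: "finite S" "card S \<le> L"
    and pq: "\<And>s. s \<in> S \<Longrightarrow> p s \<in> R" "\<And>s. s \<in> S \<Longrightarrow> q s \<in> R" "\<And>s. s \<in> S \<Longrightarrow> p s \<noteq> q s"
    and far: "\<And>z i. z \<in> X \<Longrightarrow> 1 \<le> i \<Longrightarrow> i \<le> L \<Longrightarrow> 2 * \<epsilon> < dist (T (cen (int i)) z) z"
  obtains z where "\<And>r. z r \<in> X"
    and "\<And>s. s \<in> S \<Longrightarrow> \<epsilon> < dist (T (cen (m s)) (z (p s))) (T (cen (n s)) (z (q s)))"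
proof -
  obtain w where w: "w \<in> X" using infinite_X by (metis finite.emptyI ex_in_conv)
  define P where "P = (\<lambda>z s. \<epsilon> < dist (T (cen (m s)) (z (p s))) (T (cen (n s)) (z (q s))))"
  \<comment> \<open>Two such indices would give points differing by a central shift of at most
    \<open>L\<close> and lying within \<open>2 * \<epsilon>\<close> of each other, against
    \<open>far\<close>.\<close>
  have at_most_one: "i = j"
    if "dist y (T (cen (k + int i)) w) \<le> \<epsilon>" "dist y (T (cen (k + int j)) w) \<le> \<epsilon>" "i \<le> L" "j \<le> L" for y k i j
  proof -
    have *: False if "i < j" "j \<le> L" "dist y (T (cen (k + int i)) w) \<le> \<epsilon>" "dist y (T (cen (k + int j)) w) \<le> \<epsilon>" for i j
    proof -
      have "T (cen (int (j - i))) (T (cen (k + int i)) w) = T (cen (k + int j)) w"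
        using that w by (simp add: T_cen_cen of_nat_diff algebra_simps)
      then have "2 * \<epsilon> < dist (T (cen (k + int j)) w) (T (cen (k + int i)) w)"
        using far[of "T (cen (k + int i)) w" "j - i"] that w by simp
      then show False using that dist_triangle3[of "T (cen (k + int j)) w" "T (cen (k + int i)) w" y] by simp
    qed
    show ?thesis using *[of i j] *[of j i] that by (meson linorder_neqE_nat)
  qed
  have "\<exists>z. (\<forall>r. z r \<in> X) \<and> (\<forall>s\<in>S. p s \<in> R \<longrightarrow> q s \<in> R \<longrightarrow> P z s)"
    using R
  proof (induction R rule: finite_induct)
    case empty
    show ?case using w by auto
  next
    case (insert a R)
    then obtain z where z: "\<And>r. z r \<in> X" "\<And>s. s \<in> S \<Longrightarrow> p s \<in> R \<Longrightarrow> q s \<in> R \<Longrightarrow> P z s" by blast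
    \<comment> \<open>Only constraints involving the new point \<open>a\<close> are at stake, and
      since \<open>p s \<noteq> q s\<close> just one end of each moves.\<close>
    define bad where "bad = (\<lambda>s. {i\<in>{..L}. (p s = a \<or> q s = a) \<and> \<not> P (z(a := T (cen (int i)) w)) s})"
    have "card (bad s) \<le> 1" if s: "s \<in> S" for s
    proof -
      have "i = j" if "i \<in> bad s" "j \<in> bad s" for i j
      proof (cases "p s = a")
        case True
        then have "q s \<noteq> a" using pq(3)[OF s] by simp
        then show ?thesis
          using that True w at_most_one[of "T (cen (n s)) (z (q s))" "m s" i j]
          by (auto simp: bad_def P_def T_cen_cen dist_commute)
      next
        case False
        then show ?thesis
          using that w at_most_one[of "T (cen (m s)) (z (p s))" "n s" i j]
          by (auto simp: bad_def P_def T_cen_cen)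
      qed
      moreover have "finite (bad s)" by (simp add: bad_def)
      ultimately show ?thesis by (simp add: card_le_Suc0_iff_eq)
    qed
    then have "card (\<Union>s\<in>S. bad s) \<le> L"
      using card_UN_le[OF S(1), of bad] sum_bounded_above[of S "\<lambda>s. card (bad s)" 1] S(2) by simp
    moreover have "finite (\<Union>s\<in>S. bad s)" using S by (simp add: bad_def)
    ultimately have "\<not> {..L} \<subseteq> (\<Union>s\<in>S. bad s)" using card_mono[of "\<Union>s\<in>S. bad s" "{..L}"] by auto
    then obtain i where i: "i \<le> L" "\<And>s. s \<in> S \<Longrightarrow> i \<notin> bad s" by auto
    show ?case
    proof (intro exI[of _ "z(a := T (cen (int i)) w)"] conjI ballI impI allI)
      show "(z(a := T (cen (int i)) w)) r \<in> X" for r using z w by simp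
      fix s assume s: "s \<in> S" "p s \<in> insert a R" "q s \<in> insert a R"
      show "P (z(a := T (cen (int i)) w)) s"
      proof (cases "p s = a \<or> q s = a")
        case True
        then show ?thesis using i(1) i(2)[OF s(1)] by (auto simp: bad_def)
      next
        case False
        then show ?thesis using z(2)[OF s(1)] s by (simp add: P_def)
      qed
    qed
  qed
  then show ?thesis using that pq unfolding P_def by metis
qed

text \<open>Points of different exit pairs may share a central orbit, while joinings apply only to
  unrelated points. So joinings are used on representatives, and \<open>off\<close> records the
  central shift back to the point.\<close>

lemma zrel_representatives:
  obtains rep :: "'a \<Rightarrow> 'a" and off :: "'a \<Rightarrow> int"
  where "\<And>x. x \<in> X \<Longrightarrow> rep x \<in> X" "\<And>x. x \<in> X \<Longrightarrow> T (cen (off x)) (rep x) = x"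
    and "\<And>x y. x \<in> X \<Longrightarrow> y \<in> X \<Longrightarrow> zrel (rep x) (rep y) \<Longrightarrow> rep x = rep y"
    and "\<And>x y. x \<in> X \<Longrightarrow> y \<in> X \<Longrightarrow> rep x = rep y \<Longrightarrow> zrel x y"
proof -
  define rep where "rep = (\<lambda>x. SOME y. zrel x y)"
  have rep: "zrel x (rep x)" if "x \<in> X" for x
    unfolding rep_def using zrel_refl[OF that] by (rule someI)
  have in_X: "rep x \<in> X" if "x \<in> X" for x using rep[OF that] that by (auto simp: zrel_def)
  have eq: "rep x = rep y" if "x \<in> X" "y \<in> X" "zrel x y" for x y
  proof -
    have "zrel x = zrel y" using that zrel_sym zrel_trans by blast
    then show ?thesis by (simp add: rep_def)
  qed
  have "\<exists>n. x \<in> X \<longrightarrow> T (cen n) (rep x) = x" for x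
    using zrel_sym[OF _ rep] by (metis zrel_def)
  then obtain off where "\<And>x. x \<in> X \<Longrightarrow> T (cen (off x)) (rep x) = x" by metis
  moreover have "zrel x y" if "x \<in> X" "y \<in> X" "rep x = rep y" for x y
    using that rep in_X zrel_sym zrel_trans by metis
  moreover have "rep x = rep y" if "x \<in> X" "y \<in> X" "zrel (rep x) (rep y)" for x y
    using eq that rep in_X zrel_sym zrel_trans by (metis (no_types))
  ultimately show ?thesis using that in_X by blast
qed

section \<open>Covering by half-spaces and the contradiction\<close>

lemma joinings_impossible: False
proof -
  \<comment> \<open>The Caratheodory number in dimension \<open>2 * CARD('d)\<close>;
    \<open>L\<close> pairs involve at most \<open>2 * L = 4 * CARD('d) + 2\<close> points, the order
    of the self-joining.\<close>
  define L where "L = 2 * CARD('d) + 1"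
  obtain \<epsilon> where \<epsilon>: "0 < \<epsilon>"
    and far: "\<And>z i. z \<in> X \<Longrightarrow> 1 \<le> i \<Longrightarrow> i \<le> L \<Longrightarrow> 2 * \<epsilon> < dist (T (cen (int i)) z) z"
    and generic: "\<And>n. \<not> ((\<forall>z\<in>X. dist z (T (cen n) z) \<le> \<epsilon>) \<and> (\<exists>z\<in>X. dist z (T (cen n) z) = \<epsilon>))"
    using generic_epsilon[of L] by blast
  obtain z0 where z0: "z0 \<in> X" using infinite_X by (metis finite.emptyI ex_in_conv)
  have "\<epsilon> < dist (T (cen 1) z0) z0" using far[OF z0, of 1] \<epsilon> by (simp add: L_def)
  then have "0 \<in> convex hull (exit_dirs \<epsilon>)"
    using zero_in_hull_exit_dirs[OF \<epsilon>, of "T (cen 1) z0" z0] z0 by simp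
  then obtain S where S: "finite S" "S \<subseteq> exit_dirs \<epsilon>" "card S \<le> L" "0 \<in> convex hull S"
    unfolding caratheodory[of "exit_dirs \<epsilon>"] by (auto simp: L_def)
  \<comment> \<open>Otherwise \<open>S\<close>, and with it its hull, would lie in an open
    half-space that misses \<open>0\<close>.\<close>
  have cover: "\<exists>\<xi>\<in>S. 0 \<le> inner \<xi> w" for w
  proof (rule ccontr)
    assume "\<not> ?thesis"
    then have "S \<subseteq> {\<xi>. inner w \<xi> < 0}" by (auto simp: inner_commute not_le)
    then have "convex hull S \<subseteq> {\<xi>. inner w \<xi> < 0}" by (simp add: hull_minimal convex_halfspace_lt)
    then show False using S(4) by auto
  qed
  have norm1: "norm \<xi> = 1" if "\<xi> \<in> S" for \<xi> using S that by (auto simp: exit_dirs_def)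
  have "\<exists>x x'. \<xi> \<in> S \<longrightarrow> exit_pair \<epsilon> \<xi> x x'" for \<xi> using S(2) by (auto simp: exit_dirs_def)
  then obtain x x' where pair: "\<And>\<xi>. \<xi> \<in> S \<Longrightarrow> exit_pair \<epsilon> \<xi> (x \<xi>) (x' \<xi>)" by metis
  \<comment> \<open>Shifting the pair by an element of the open half-space makes it close on the
    closed half-space, as \<open>cover\<close> requires. The length \<open>2 * CARD('d) + 1\<close>
    exceeds the rounding error of \<open>heis_approx\<close>.\<close>
  have "\<exists>h :: 'd heisenberg. \<xi> \<in> S \<longrightarrow> 0 < inner \<xi> (hor h)" for \<xi>
  proof -
    obtain h :: "'d heisenberg" where h: "norm (hor h - (2 * CARD('d) + 1) *\<^sub>R \<xi>) \<le> 2 * CARD('d)"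
      using heis_approx by metis
    have "0 < inner \<xi> (hor h)" if "\<xi> \<in> S"
    proof -
      have "inner \<xi> (hor h) = inner \<xi> (hor h - (2 * CARD('d) + 1) *\<^sub>R \<xi>) + (2 * CARD('d) + 1)"
        using norm1[OF that] by (simp add: inner_simps norm_eq_1)
      moreover have "\<bar>inner \<xi> (hor h - (2 * CARD('d) + 1) *\<^sub>R \<xi>)\<bar> \<le> 2 * CARD('d)"
        using Cauchy_Schwarz_ineq2[of \<xi> "hor h - (2 * CARD('d) + 1) *\<^sub>R \<xi>"] norm1[OF that] h by simp
      ultimately show ?thesis by linarith
    qed
    then show ?thesis by blast
  qed
  then obtain h :: "_ \<Rightarrow> 'd heisenberg" where h: "\<And>\<xi>. \<xi> \<in> S \<Longrightarrow> 0 < inner \<xi> (hor (h \<xi>))" by metis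
  define p q where "p = (\<lambda>\<xi>. T (h \<xi>) (x \<xi>))" and "q = (\<lambda>\<xi>. T (h \<xi>) (x' \<xi>))"
  have xX: "x \<xi> \<in> X" "x' \<xi> \<in> X" if "\<xi> \<in> S" for \<xi> using pair[OF that] by (simp_all add: exit_pair_def)
  have pX: "p \<xi> \<in> X" "q \<xi> \<in> X" if "\<xi> \<in> S" for \<xi> using xX[OF that] by (simp_all add: p_def q_def)
  have close: "dist (T g (p \<xi>)) (T g (q \<xi>)) \<le> \<epsilon>" if "\<xi> \<in> S" "0 \<le> inner \<xi> (hor g)" for g \<xi>
  proof -
    have "0 < inner \<xi> (hor (g \<star> h \<xi>))" using h that by (simp add: inner_add_right add_nonneg_pos)
    then show ?thesis
      using pair[OF that(1)] xX[OF that(1)] unfolding exit_pair_def p_def q_def by (metis T_mult)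
  qed
  have pq: "\<not> zrel (p \<xi>) (q \<xi>)" if "\<xi> \<in> S" for \<xi>
    using exit_pair_not_zrel[OF pair[OF that] norm1[OF that] generic] zrel_T xX[OF that]
    unfolding p_def q_def by blast
  obtain rep off where rep: "\<And>x. x \<in> X \<Longrightarrow> rep x \<in> X" "\<And>x. x \<in> X \<Longrightarrow> T (cen (off x)) (rep x) = x"
    "\<And>x y. x \<in> X \<Longrightarrow> y \<in> X \<Longrightarrow> zrel (rep x) (rep y) \<Longrightarrow> rep x = rep y"
    "\<And>x y. x \<in> X \<Longrightarrow> y \<in> X \<Longrightarrow> rep x = rep y \<Longrightarrow> zrel x y"
    using zrel_representatives by blast
  define R where "R = rep ` (p ` S \<union> q ` S)"
  have R: "finite R" "R \<subseteq> X" using S(1) pX rep(1) by (auto simp: R_def)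
  have "card R \<le> card (p ` S \<union> q ` S)" unfolding R_def using S(1) by (intro card_image_le) simp
  also have "\<dots> \<le> card (p ` S) + card (q ` S)" by (rule card_Un_le)
  also have "\<dots> \<le> L + L" using S by (intro add_mono order_trans[OF card_image_le]) auto
  finally have cardR: "card R \<le> 4 * CARD('d) + 2" by (simp add: L_def)
  have unrel: "\<not> zrel a b" if "a \<in> R" "b \<in> R" "a \<noteq> b" for a b
    using that rep(3) pX unfolding R_def by blast
  obtain z where z: "\<And>r. z r \<in> X"
    "\<And>\<xi>. \<xi> \<in> S \<Longrightarrow> \<epsilon> < dist (T (cen (off (p \<xi>))) (z (rep (p \<xi>)))) (T (cen (off (q \<xi>))) (z (rep (q \<xi>))))"
  proof (rule separating_targets[OF R(1) S(1,3), where p = "\<lambda>\<xi>. rep (p \<xi>)" and q = "\<lambda>\<xi>. rep (q \<xi>)"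
        and \<epsilon> = \<epsilon> and m = "\<lambda>\<xi>. off (p \<xi>)" and n = "\<lambda>\<xi>. off (q \<xi>)"])
    show "rep (p \<xi>) \<noteq> rep (q \<xi>)" if "\<xi> \<in> S" for \<xi> using rep(4) pX[OF that] pq[OF that] by blast
  qed (use far in \<open>auto simp: R_def\<close>)
  obtain g :: "nat \<Rightarrow> 'd heisenberg" where g: "\<And>r. r \<in> R \<Longrightarrow> (\<lambda>k. T (g k) r) \<longlonglongrightarrow> z r"
    using joinings_limit[OF R cardR unrel, of z] z(1) by blast
  \<comment> \<open>Central shifts commute with \<open>g k\<close>, so the limit at a representative
    determines the limit on its central orbit.\<close>
  have lim: "(\<lambda>k. T (g k) y) \<longlonglongrightarrow> T (cen (off y)) (z (rep y))" if "y \<in> X" "rep y \<in> R" for y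
  proof -
    have "(\<lambda>k. T (cen (off y)) (T (g k) (rep y))) \<longlonglongrightarrow> T (cen (off y)) (z (rep y))"
      using T_tendsto[OF g[OF that(2)] z(1)] rep(1)[OF that(1)] by simp
    then show ?thesis
      using T_cen_commute[OF rep(1)[OF that(1)], of _ "off y"] rep(2)[OF that(1)] by simp
  qed
  have "\<forall>\<^sub>F k in sequentially. \<epsilon> < dist (T (g k) (p \<xi>)) (T (g k) (q \<xi>))" if "\<xi> \<in> S" for \<xi>
  proof -
    have "(\<lambda>k. dist (T (g k) (p \<xi>)) (T (g k) (q \<xi>)))
        \<longlonglongrightarrow> dist (T (cen (off (p \<xi>))) (z (rep (p \<xi>)))) (T (cen (off (q \<xi>))) (z (rep (q \<xi>))))"
      using pX[OF that] that by (intro tendsto_dist lim) (auto simp: R_def)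
    then show ?thesis using z(2)[OF that] by (rule order_tendstoD)
  qed
  then have "\<forall>\<^sub>F k in sequentially. \<forall>\<xi>\<in>S. \<epsilon> < dist (T (g k) (p \<xi>)) (T (g k) (q \<xi>))"
    using S(1) by (simp add: eventually_ball_finite)
  then obtain k where k: "\<forall>\<xi>\<in>S. \<epsilon> < dist (T (g k) (p \<xi>)) (T (g k) (q \<xi>))"
    using eventually_happens' sequentially_bot by blast
  obtain \<xi> where "\<xi> \<in> S" "0 \<le> inner \<xi> (hor (g k))" using cover by blast
  then show False using k close by (meson not_le)
qed

end

theorem theorem5:
  fixes X :: "'a::metric_space set"
    and T :: "('d::finite) heisenberg \<Rightarrow> 'a \<Rightarrow> 'a"
  assumes "topological_dynamical_system heisenberg_group X T"
  shows "\<not> strong_TMSJ (4 * CARD('d) + 2) heisenberg_group X T"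
proof
  assume "strong_TMSJ (4 * CARD('d) + 2) heisenberg_group X T"
  then have "heis_joinings X T"
    using assms by (simp add: heis_joinings_def heis_joinings_axioms_def)
  then show False by (rule heis_joinings.joinings_impossible)
qed

end
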